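(* For an infinitesimal law $\tilde\mu$ on $k$ variables and real $t\ge 0$, define $\tilde{\mathbb{B}}_t(\tilde\mu):=\left(\tilde\mu^{\boxplus (1+t)}\right)^{\uplus \frac{1}{1+t}}$. Then: (1) $\tilde{\mathbb{B}}_s\circ\tilde{\mathbb{B}}_t=\tilde{\mathbb{B}}_{s+t}$ for all $s,t\ge 0$; (2) for every $n\ge 1$, $\tilde r_n(\tilde{\mathbb{B}}_1(\tilde\mu))=\tilde b_n(\tilde\mu)$; that is, $\tilde{\mathbb{B}}_1(\tilde\mu)$ is the image of $\tilde\mu$ under the infinitesimal Boolean Bercovici–Pata bijection.
   Context: The Grassmann algebra is $\mathbb{G}=\{z+\hbar w: z,w\in\mathbb{C}\}$, a commutative $\mathbb{C}$-algebra with $\hbar^2=0$. An infinitesimal law on $k$ variables is a pair $\tilde\mu=(\mu,\mu^\prime)$ of linear functionals on $\mathbb{C}\langle X_1,\dots,X_k\rangle$ with $\mu(1)=1$, $\mu^\prime(1)=0$; view it as the infinitesimal non-commutative probability space $(\mathbb{C}\langle X_1,\dots,X_k\rangle,\mu,\mu^\prime)$. Its $\mathbb{G}$-valued free cumulants are $\tilde r_n=r_n+\hbar r^\prime_n$ and Boolean cumulants $\tilde b_n=b_n+\hbar b^\prime_n$ (multilinear maps on $(\mathbb{C}\langle X_1,\dots,X_k\rangle)^n$, regarded via their values on all tuples $(X_{i_1},\dots,X_{i_n})$), where, with $\mu_n(a_1,\dots,a_n)=\mu(a_1\cdots a_n)$, $\mu^\prime_n$ similarly, these are defined recursively by $\mu_n=\sum_{\pi\in\mathcal{NC}(n)}r_\pi$,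 $\mu^\prime_n=\sum_{\pi\in\mathcal{NC}(n)}\partial r_\pi$, $\mu_n=\sum_{\pi\in\mathcal{I}(n)}b_\pi$, $\mu^\prime_n=\sum_{\pi\in\mathcal{I}(n)}\partial b_\pi$. Here $\mathcal{NC}(n)$, $\mathcal{I}(n)$ are the non-crossing resp. interval partitions of $[n]$, $f_\pi(a_1,\dots,a_n)=\prod_{V\in\pi}f_{|V|}(a_V)$ (arguments in a block taken in increasing order), and $\partial f_\pi=\sum_{V\in\pi}f^\prime_{|V|}(a_V)\prod_{W\ne V}f_{|W|}(a_W)$. An infinitesimal law is determined by its $\tilde r_n$'s, and also by its $\tilde b_n$'s. For $s\ge0$, $\tilde\mu^{\boxplus s}$ is the infinitesimal law with $\tilde r_n(\tilde\mu^{\boxplus s})=s\,\tilde r_n(\tilde\mu)$ for all $n$, and $\tilde\mu^{\uplus s}$ the one with $\tilde b_n(\tilde\mu^{\uplus s})=s\,\tilde b_n(\tilde\mu)$ for all $n$. The infinitesimal Boolean Bercovici–Pata bijection $\tilde{\mathbb{B}}$ sends $\tilde\mu$ to the unique infinitesimal law $\tilde{\mathbb{B}}(\tilde\mu)$ with $\tilde r_n(\tilde{\mathbb{B}}(\tilde\mu))=\tilde b_n(\tilde\mu)$ for all $n$. *)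

theory Defs
  imports Complex_Main "HOL-Library.Poly_Mapping" "HOL-Library.Disjoint_Sets"
begin

section \<open>The Grassmann algebra\<close>

text \<open>\<open>Grassmann z w\<close> is the element $z + \hbar w$.\<close>

datatype grassmann = Grassmann (gbody: complex) (gsoul: complex)

instantiation grassmann :: "{comm_ring_1, real_algebra_1}"
begin

definition zero_grassmann :: grassmann where "0 = Grassmann 0 0"
definition one_grassmann :: grassmann where "1 = Grassmann 1 0"
definition plus_grassmann :: "grassmann \<Rightarrow> grassmann \<Rightarrow> grassmann" where
  "x + y = Grassmann (gbody x + gbody y) (gsoul x + gsoul y)"
definition uminus_grassmann :: "grassmann \<Rightarrow> grassmann" where
  "- x = Grassmann (- gbody x) (- gsoul x)"
definition minus_grassmann :: "grassmann \<Rightarrow> grassmann \<Rightarrow> grassmann" where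
  "x - y = Grassmann (gbody x - gbody y) (gsoul x - gsoul y)"
definition times_grassmann :: "grassmann \<Rightarrow> grassmann \<Rightarrow> grassmann" where
  "x * y = Grassmann (gbody x * gbody y) (gbody x * gsoul y + gsoul x * gbody y)"
definition scaleR_grassmann :: "real \<Rightarrow> grassmann \<Rightarrow> grassmann" where
  "c *\<^sub>R x = Grassmann (c *\<^sub>R gbody x) (c *\<^sub>R gsoul x)"

instance
  by standard
    (auto simp: zero_grassmann_def one_grassmann_def plus_grassmann_def uminus_grassmann_def
      minus_grassmann_def times_grassmann_def scaleR_grassmann_def algebra_simps
      intro!: grassmann.expand)

end


section \<open>Non-commutative polynomials\<close>

text \<open>
  The algebra of non-commutative polynomials is the monoid algebra of the free monoid.  Since
  \<^theory>\<open>HOL-Library.Poly_Mapping\<close> writes the exponent monoid additively, concatenation of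
  words is \<open>+\<close> and the empty word is \<open>0\<close>.
\<close>

datatype 'k free_monoid = Word (letters: "'k list")

instantiation free_monoid :: (type) monoid_add
begin

definition zero_free_monoid :: "'a free_monoid" where "0 = Word []"
definition plus_free_monoid :: "'a free_monoid \<Rightarrow> 'a free_monoid \<Rightarrow> 'a free_monoid" where
  "u + v = Word (letters u @ letters v)"

instance
  by standard (auto simp: zero_free_monoid_def plus_free_monoid_def)

end

type_synonym 'k ncpoly = "'k free_monoid \<Rightarrow>\<^sub>0 complex"

definition X :: "'k \<Rightarrow> 'k ncpoly" where
  "X i = Poly_Mapping.single (Word [i]) 1"

abbreviation ncscale :: "complex \<Rightarrow> 'k ncpoly \<Rightarrow> 'k ncpoly" where
  "ncscale c \<equiv> Poly_Mapping.map ((*) c)"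

lemma lookup_ncscale [simp]: "Poly_Mapping.lookup (ncscale c p) w = c * Poly_Mapping.lookup p w"
  by (simp add: Poly_Mapping.map.rep_eq when_def)

lemma vector_space_ncscale: "vector_space (ncscale :: complex \<Rightarrow> 'k ncpoly \<Rightarrow> 'k ncpoly)"
  by standard (auto intro!: poly_mapping_eqI simp: lookup_add algebra_simps)

lemma vector_space_complex: "vector_space ((*) :: complex \<Rightarrow> complex \<Rightarrow> complex)"
  by standard (auto simp: algebra_simps)


section \<open>Infinitesimal laws\<close>

lemma linear_functional_iff:
  "Vector_Spaces.linear ncscale (*) (f :: 'k ncpoly \<Rightarrow> complex) \<longleftrightarrow>
     (\<forall>p q. f (p + q) = f p + f q) \<and> (\<forall>c p. f (ncscale c p) = c * f p)"
  by (simp add: module_hom_iff_linear[symmetric] module_hom_iff module_iff_vector_space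
      vector_space_ncscale vector_space_complex)

typedef 'k inf_law =
  "{(\<mu> :: 'k ncpoly \<Rightarrow> complex, \<mu>' :: 'k ncpoly \<Rightarrow> complex).
      Vector_Spaces.linear ncscale (*) \<mu> \<and> Vector_Spaces.linear ncscale (*) \<mu>' \<and>
      \<mu> 1 = 1 \<and> \<mu>' 1 = 0}"
  by (rule exI[of _ "(\<lambda>p. Poly_Mapping.lookup p 0, \<lambda>p. 0)"])
    (simp add: linear_functional_iff lookup_add lookup_one)

definition law :: "'k inf_law \<Rightarrow> 'k ncpoly \<Rightarrow> complex" where
  "law M = fst (Rep_inf_law M)"

definition law' :: "'k inf_law \<Rightarrow> 'k ncpoly \<Rightarrow> complex" where
  "law' M = snd (Rep_inf_law M)"


section \<open>Non-crossing and interval partitions\<close>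

text \<open>Partitions of $[n]$ are modelled as partitions of \<open>{..<n}\<close>.\<close>

definition NC :: "nat \<Rightarrow> nat set set set" where
  "NC n = {\<pi>. partition_on {..<n} \<pi> \<and>
     \<not> (\<exists>V\<in>\<pi>. \<exists>W\<in>\<pi>. V \<noteq> W \<and>
          (\<exists>a\<in>V. \<exists>b\<in>W. \<exists>c\<in>V. \<exists>d\<in>W. a < b \<and> b < c \<and> c < d))}"

definition IP :: "nat \<Rightarrow> nat set set set" where
  "IP n = {\<pi>. partition_on {..<n} \<pi> \<and> (\<forall>V\<in>\<pi>. \<exists>i j. V = {i..j})}"

text \<open>
  A family \<open>(f\<^sub>n)\<close> of $n$-ary functionals is a function on lists; \<open>nths xs V\<close> lists the
  arguments with index in \<open>V\<close> in increasing order.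
\<close>

definition part_prod :: "('a list \<Rightarrow> complex) \<Rightarrow> nat set set \<Rightarrow> 'a list \<Rightarrow> complex" where
  "part_prod f \<pi> xs = (\<Prod>V\<in>\<pi>. f (nths xs V))"

definition part_deriv ::
  "('a list \<Rightarrow> complex) \<Rightarrow> ('a list \<Rightarrow> complex) \<Rightarrow> nat set set \<Rightarrow> 'a list \<Rightarrow> complex" where
  "part_deriv f f' \<pi> xs = (\<Sum>V\<in>\<pi>. f' (nths xs V) * (\<Prod>W\<in>\<pi>-{V}. f (nths xs W)))"

lemma part_prod_cong [fundef_cong]:
  assumes "\<pi> = \<rho>" "xs = ys" "\<And>V. V \<in> \<rho> \<Longrightarrow> f (nths ys V) = g (nths ys V)"
  shows "part_prod f \<pi> xs = part_prod g \<rho> ys"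
  unfolding part_prod_def using assms by (auto intro!: prod.cong)

lemma part_deriv_cong [fundef_cong]:
  assumes "\<pi> = \<rho>" "xs = ys" "\<And>V. V \<in> \<rho> \<Longrightarrow> f (nths ys V) = g (nths ys V)"
    "\<And>V. V \<in> \<rho> \<Longrightarrow> f' (nths ys V) = g' (nths ys V)"
  shows "part_deriv f f' \<pi> xs = part_deriv g g' \<rho> ys"
  unfolding part_deriv_def using assms by (auto intro!: sum.cong prod.cong)

lemma length_nths_less:
  assumes "partition_on {..<length xs} \<pi>" "\<pi> \<noteq> {{..<length xs}}" "V \<in> \<pi>"
  shows "length (nths xs V) < length xs"
proof -
  have sub: "V \<subseteq> {..<length xs}" using assms by (auto simp: partition_on_def)
  have "V \<noteq> {..<length xs}"
  proof
    assume V: "V = {..<length xs}"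
    have "W = V" if "W \<in> \<pi>" for W
    proof (rule ccontr)
      assume "W \<noteq> V"
      then have "W \<inter> V = {}" "W \<noteq> {}" "W \<subseteq> V"
        using assms that V by (auto simp: partition_on_def disjoint_def)
      then show False by auto
    qed
    then have "\<pi> = {V}" using assms(3) by blast
    then show False using assms(2) unfolding V by contradiction
  qed
  with sub have "V \<subset> {..<length xs}" by auto
  then have "card V < card {..<length xs}" by (intro psubset_card_mono) auto
  moreover have "{i. i < length xs \<and> i \<in> V} = V" using sub by auto
  ultimately show ?thesis by (simp add: length_nths)
qed


section \<open>Cumulants\<close>

text \<open>
  The moment-cumulant formulas are solved for the term of the one-block partition
  \<open>{{..<n}}\<close>; in their original form they are the lemmas \<open>moment_free_cumulant\<close> etc. below.
\<close>

function free_cumulant :: "('a::monoid_mult \<Rightarrow> complex) \<Rightarrow> 'a list \<Rightarrow> complex" where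
  "free_cumulant \<phi> xs = \<phi> (prod_list xs) -
     (\<Sum>\<pi> \<in> NC (length xs) - {{{..<length xs}}}. part_prod (free_cumulant \<phi>) \<pi> xs)"
  by pat_completeness auto
termination
  by (relation "Wellfounded.measure (length \<circ> snd)") (auto simp: NC_def intro: length_nths_less)

function inf_free_cumulant ::
  "('a::monoid_mult \<Rightarrow> complex) \<Rightarrow> ('a \<Rightarrow> complex) \<Rightarrow> 'a list \<Rightarrow> complex" where
  "inf_free_cumulant \<phi> \<phi>' xs = \<phi>' (prod_list xs) -
     (\<Sum>\<pi> \<in> NC (length xs) - {{{..<length xs}}}.
        part_deriv (free_cumulant \<phi>) (inf_free_cumulant \<phi> \<phi>') \<pi> xs)"
  by pat_completeness auto
termination
  by (relation "Wellfounded.measure (length \<circ> snd \<circ> snd)")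
    (auto simp: NC_def intro: length_nths_less)

function boolean_cumulant :: "('a::monoid_mult \<Rightarrow> complex) \<Rightarrow> 'a list \<Rightarrow> complex" where
  "boolean_cumulant \<phi> xs = \<phi> (prod_list xs) -
     (\<Sum>\<pi> \<in> IP (length xs) - {{{..<length xs}}}. part_prod (boolean_cumulant \<phi>) \<pi> xs)"
  by pat_completeness auto
termination
  by (relation "Wellfounded.measure (length \<circ> snd)") (auto simp: IP_def intro: length_nths_less)

function inf_boolean_cumulant ::
  "('a::monoid_mult \<Rightarrow> complex) \<Rightarrow> ('a \<Rightarrow> complex) \<Rightarrow> 'a list \<Rightarrow> complex" where
  "inf_boolean_cumulant \<phi> \<phi>' xs = \<phi>' (prod_list xs) -
     (\<Sum>\<pi> \<in> IP (length xs) - {{{..<length xs}}}.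
        part_deriv (boolean_cumulant \<phi>) (inf_boolean_cumulant \<phi> \<phi>') \<pi> xs)"
  by pat_completeness auto
termination
  by (relation "Wellfounded.measure (length \<circ> snd \<circ> snd)")
    (auto simp: IP_def intro: length_nths_less)

declare free_cumulant.simps [simp del] inf_free_cumulant.simps [simp del]
  boolean_cumulant.simps [simp del] inf_boolean_cumulant.simps [simp del]


section \<open>Moment-cumulant formulas\<close>

lemma partition_on_NC: "\<pi> \<in> NC n \<Longrightarrow> partition_on {..<n} \<pi>"
  by (simp add: NC_def)

lemma partition_on_IP: "\<pi> \<in> IP n \<Longrightarrow> partition_on {..<n} \<pi>"
  by (simp add: IP_def)

lemma finite_NC: "finite (NC n)"
  by (rule finite_subset[OF _ finitely_many_partition_on[of "{..<n}"]]) (auto simp: NC_def)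

lemma finite_IP: "finite (IP n)"
  by (rule finite_subset[OF _ finitely_many_partition_on[of "{..<n}"]]) (auto simp: IP_def)

lemma one_block_NC: "n > 0 \<Longrightarrow> {{..<n}} \<in> NC n"
  by (auto simp: NC_def intro!: partition_on_space)

lemma one_block_IP:
  assumes "n > 0"
  shows "{{..<n}} \<in> IP n"
proof -
  have "{..<n} = {0..n - 1}" using assms by auto
  then show ?thesis using assms unfolding IP_def by (blast intro: partition_on_space)
qed

lemma part_prod_one_block: "part_prod f {{..<length xs}} xs = f xs"
  by (simp add: part_prod_def)

lemma part_deriv_one_block: "part_deriv f f' {{..<length xs}} xs = f' xs"
  by (simp add: part_deriv_def)

lemma moment_free_cumulant:
  assumes "xs \<noteq> []"
  shows "\<phi> (prod_list xs) = (\<Sum>\<pi>\<in>NC (length xs). part_prod (free_cumulant \<phi>) \<pi> xs)"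
proof -
  have "length xs > 0" using assms by simp
  then show ?thesis
    by (simp only: sum.remove[OF finite_NC one_block_NC] part_prod_one_block diff_add_cancel
        free_cumulant.simps[of \<phi> xs])
qed

lemma inf_moment_free_cumulant:
  assumes "xs \<noteq> []"
  shows "\<phi>' (prod_list xs) =
    (\<Sum>\<pi>\<in>NC (length xs). part_deriv (free_cumulant \<phi>) (inf_free_cumulant \<phi> \<phi>') \<pi> xs)"
proof -
  have "length xs > 0" using assms by simp
  then show ?thesis
    by (simp only: sum.remove[OF finite_NC one_block_NC] part_deriv_one_block diff_add_cancel
        inf_free_cumulant.simps[of \<phi> \<phi>' xs])
qed

lemma moment_boolean_cumulant:
  assumes "xs \<noteq> []"
  shows "\<phi> (prod_list xs) = (\<Sum>\<pi>\<in>IP (length xs). part_prod (boolean_cumulant \<phi>) \<pi> xs)"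
proof -
  have "length xs > 0" using assms by simp
  then show ?thesis
    by (simp only: sum.remove[OF finite_IP one_block_IP] part_prod_one_block diff_add_cancel
        boolean_cumulant.simps[of \<phi> xs])
qed

lemma inf_moment_boolean_cumulant:
  assumes "xs \<noteq> []"
  shows "\<phi>' (prod_list xs) =
    (\<Sum>\<pi>\<in>IP (length xs). part_deriv (boolean_cumulant \<phi>) (inf_boolean_cumulant \<phi> \<phi>') \<pi> xs)"
proof -
  have "length xs > 0" using assms by simp
  then show ?thesis
    by (simp only: sum.remove[OF finite_IP one_block_IP] part_deriv_one_block diff_add_cancel
        inf_boolean_cumulant.simps[of \<phi> \<phi>' xs])
qed


section \<open>Laws are parametrised by their cumulants\<close>

lemma part_prod_map: "part_prod f \<pi> (map h xs) = part_prod (\<lambda>ys. f (map h ys)) \<pi> xs"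
  by (simp add: part_prod_def nths_map)

lemma part_deriv_map:
  "part_deriv f f' \<pi> (map h xs) = part_deriv (\<lambda>ys. f (map h ys)) (\<lambda>ys. f' (map h ys)) \<pi> xs"
  by (simp add: part_deriv_def nths_map)

lemma nths_block_nonempty:
  assumes "partition_on {..<length xs} \<pi>" "V \<in> \<pi>"
  shows "nths xs V \<noteq> []"
proof -
  have "V \<noteq> {}" "V \<subseteq> {..<length xs}" using assms unfolding partition_on_def by blast+
  then obtain i where "i \<in> V" "i < length xs" by blast
  then have "xs ! i \<in> set (nths xs V)" unfolding set_nths by blast
  then show ?thesis by auto
qed

lemma part_prod_unique:
  fixes P :: "nat \<Rightarrow> nat set set set"
  assumes fin: "\<And>n. finite (P n)" and one: "\<And>n. n > 0 \<Longrightarrow> {{..<n}} \<in> P n"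
    and part: "\<And>n \<pi>. \<pi> \<in> P n \<Longrightarrow> partition_on {..<n} \<pi>"
    and eq: "\<And>xs. xs \<noteq> [] \<Longrightarrow> (\<Sum>\<pi>\<in>P (length xs). part_prod f \<pi> xs) =
      (\<Sum>\<pi>\<in>P (length xs). part_prod g \<pi> xs)"
  shows "xs \<noteq> [] \<Longrightarrow> f xs = g xs"
proof (induction xs rule: length_induct)
  case (1 xs)
  have len: "length xs > 0" using 1 by simp
  have "part_prod f \<pi> xs = part_prod g \<pi> xs" if "\<pi> \<in> P (length xs) - {{{..<length xs}}}" for \<pi>
  proof (rule part_prod_cong)
    fix V assume V: "V \<in> \<pi>"
    have "length (nths xs V) < length xs" "nths xs V \<noteq> []"
      using length_nths_less[OF part _ V] nths_block_nonempty[OF part V] that by blast+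
    then show "f (nths xs V) = g (nths xs V)" using 1(1) by blast
  qed simp_all
  then have "(\<Sum>\<pi>\<in>P (length xs) - {{{..<length xs}}}. part_prod f \<pi> xs) =
      (\<Sum>\<pi>\<in>P (length xs) - {{{..<length xs}}}. part_prod g \<pi> xs)"
    by (intro sum.cong) auto
  moreover have "(\<Sum>\<pi>\<in>P (length xs). part_prod h \<pi> xs) =
      h xs +
      (\<Sum>\<pi>\<in>P (length xs) - {{{..<length xs}}}. part_prod h \<pi> xs)" for h
    by (subst sum.remove[OF fin one[OF len]]) (simp add: part_prod_one_block)
  ultimately show ?case using eq[OF 1(2)] by simp
qed

lemma part_deriv_unique:
  fixes P :: "nat \<Rightarrow> nat set set set"
  assumes fin: "\<And>n. finite (P n)" and one: "\<And>n. n > 0 \<Longrightarrow> {{..<n}} \<in> P n"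
    and part: "\<And>n \<pi>. \<pi> \<in> P n \<Longrightarrow> partition_on {..<n} \<pi>"
    and fg: "\<And>xs. xs \<noteq> [] \<Longrightarrow> f xs = g xs"
    and eq: "\<And>xs. xs \<noteq> [] \<Longrightarrow> (\<Sum>\<pi>\<in>P (length xs). part_deriv f f' \<pi> xs) =
      (\<Sum>\<pi>\<in>P (length xs). part_deriv g g' \<pi> xs)"
  shows "xs \<noteq> [] \<Longrightarrow> f' xs = g' xs"
proof (induction xs rule: length_induct)
  case (1 xs)
  have len: "length xs > 0" using 1 by simp
  have "part_deriv f f' \<pi> xs = part_deriv g g' \<pi> xs"
    if "\<pi> \<in> P (length xs) - {{{..<length xs}}}" for \<pi>
  proof (rule part_deriv_cong)
    fix V assume V: "V \<in> \<pi>"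
    have "length (nths xs V) < length xs" "nths xs V \<noteq> []"
      using length_nths_less[OF part _ V] nths_block_nonempty[OF part V] that by blast+
    then show "f (nths xs V) = g (nths xs V)" "f' (nths xs V) = g' (nths xs V)"
      using 1(1) fg by blast+
  qed simp_all
  then have "(\<Sum>\<pi>\<in>P (length xs) - {{{..<length xs}}}. part_deriv f f' \<pi> xs) =
      (\<Sum>\<pi>\<in>P (length xs) - {{{..<length xs}}}. part_deriv g g' \<pi> xs)"
    by (intro sum.cong) auto
  moreover have "(\<Sum>\<pi>\<in>P (length xs). part_deriv h h' \<pi> xs) =
      h' xs +
      (\<Sum>\<pi>\<in>P (length xs) - {{{..<length xs}}}. part_deriv h h' \<pi> xs)" for h h'
    by (subst sum.remove[OF fin one[OF len]]) (simp add: part_deriv_one_block)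
  ultimately show ?case using eq[OF 1(2)] by simp
qed

lemma prod_list_X: "prod_list (map X ks) = Poly_Mapping.single (Word ks) 1"
proof (induction ks)
  case Nil
  show ?case by (simp add: zero_free_monoid_def[symmetric])
next
  case (Cons k ks)
  then show ?case by (simp add: X_def mult_single plus_free_monoid_def)
qed

lemma linear_functional_eqI:
  fixes f g :: "'k ncpoly \<Rightarrow> complex"
  assumes f: "Vector_Spaces.linear ncscale (*) f" and g: "Vector_Spaces.linear ncscale (*) g"
    and eq: "\<And>ks. f (prod_list (map X ks)) = g (prod_list (map X ks))"
  shows "f = g"
proof
  fix p
  have zero: "f 0 = 0" "g 0 = 0"
    using f g unfolding linear_functional_iff by (metis add_cancel_right_left)+
  show "f p = g p"
  proof (induction p rule: Poly_Mapping.update_induct)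
    case const
    show ?case using zero by simp
  next
    case (update p w b)
    have "Poly_Mapping.update w b p = p + ncscale b (Poly_Mapping.single w 1)"
      using update(1)
      by (intro poly_mapping_eqI)
        (auto simp: lookup_update lookup_add lookup_single when_def in_keys_iff)
    moreover have "f (Poly_Mapping.single w 1) = g (Poly_Mapping.single w 1)"
      using eq[of "letters w"] by (simp add: prod_list_X)
    ultimately show ?case
      using f g update(3) unfolding linear_functional_iff by metis
  qed
qed

definition ncext :: "('k list \<Rightarrow> complex) \<Rightarrow> 'k ncpoly \<Rightarrow> complex" where
  "ncext m p = (\<Sum>w\<in>Poly_Mapping.keys p. Poly_Mapping.lookup p w * m (letters w))"

lemma ncext_superset:
  assumes "finite S" "Poly_Mapping.keys p \<subseteq> S"
  shows "ncext m p = (\<Sum>w\<in>S. Poly_Mapping.lookup p w * m (letters w))"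
  unfolding ncext_def using assms by (intro sum.mono_neutral_left) (auto simp: in_keys_iff)

lemma linear_ncext: "Vector_Spaces.linear ncscale (*) (ncext m)"
  unfolding linear_functional_iff
proof (intro conjI allI)
  fix p q :: "'a ncpoly" and c :: complex
  let ?S = "Poly_Mapping.keys p \<union> Poly_Mapping.keys q"
  have "ncext m (p + q) = (\<Sum>w\<in>?S. Poly_Mapping.lookup (p + q) w * m (letters w))"
    "ncext m p = (\<Sum>w\<in>?S. Poly_Mapping.lookup p w * m (letters w))"
    "ncext m q = (\<Sum>w\<in>?S. Poly_Mapping.lookup q w * m (letters w))"
    using Poly_Mapping.keys_add[of p q] by (intro ncext_superset; auto)+
  then show "ncext m (p + q) = ncext m p + ncext m q"
    by (simp add: lookup_add algebra_simps sum.distrib)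
  have "ncext m (ncscale c p) =
      (\<Sum>w\<in>Poly_Mapping.keys p. Poly_Mapping.lookup (ncscale c p) w * m (letters w))"
    by (intro ncext_superset) (auto simp: in_keys_iff)
  then show "ncext m (ncscale c p) = c * ncext m p"
    by (simp add: ncext_def sum_distrib_left algebra_simps)
qed

lemma ncext_X: "ncext m (prod_list (map X ks)) = m ks"
  by (simp add: prod_list_X ncext_def)

lemma ncext_one: "ncext m 1 = m []"
  using ncext_X[of m "[]"] by simp

lemma law_props:
  "Vector_Spaces.linear ncscale (*) (law M)" "Vector_Spaces.linear ncscale (*) (law' M)"
  "law M 1 = 1" "law' M 1 = 0"
  using Rep_inf_law[of M] by (auto simp: law_def law'_def)

lemma inf_law_eqI:
  assumes "\<And>ks. ks \<noteq> [] \<Longrightarrow> law M (prod_list (map X ks)) = law N (prod_list (map X ks))"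
    and "\<And>ks. ks \<noteq> [] \<Longrightarrow> law' M (prod_list (map X ks)) = law' N (prod_list (map X ks))"
  shows "M = N"
proof -
  have "law M (prod_list (map X ks)) = law N (prod_list (map X ks))"
    "law' M (prod_list (map X ks)) = law' N (prod_list (map X ks))" for ks
    using assms by (cases "ks = []"; simp add: law_props)+
  then have "law M = law N" "law' M = law' N" by (auto intro!: linear_functional_eqI law_props)
  then show ?thesis by (simp add: Rep_inf_law_inject[symmetric] law_def law'_def prod_eq_iff)
qed

lemma cumulants_ex1:
  fixes P :: "nat \<Rightarrow> nat set set set"
    and c :: "('k ncpoly \<Rightarrow> complex) \<Rightarrow> 'k ncpoly list \<Rightarrow> complex"
    and c' :: "('k ncpoly \<Rightarrow> complex) \<Rightarrow> ('k ncpoly \<Rightarrow> complex) \<Rightarrow> 'k ncpoly list \<Rightarrow> complex"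
    and g :: "'k list \<Rightarrow> grassmann"
  assumes fin: "\<And>n. finite (P n)" and one: "\<And>n. n > 0 \<Longrightarrow> {{..<n}} \<in> P n"
    and part: "\<And>n \<pi>. \<pi> \<in> P n \<Longrightarrow> partition_on {..<n} \<pi>"
    and c: "\<And>\<phi> xs. xs \<noteq> [] \<Longrightarrow> \<phi> (prod_list xs) = (\<Sum>\<pi>\<in>P (length xs). part_prod (c \<phi>) \<pi> xs)"
    and c': "\<And>\<phi> \<phi>' xs. xs \<noteq> [] \<Longrightarrow>
      \<phi>' (prod_list xs) = (\<Sum>\<pi>\<in>P (length xs). part_deriv (c \<phi>) (c' \<phi> \<phi>') \<pi> xs)"
  shows "\<exists>!N. \<forall>n\<ge>1. \<forall>ks. length ks = n \<longrightarrow>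
    Grassmann (c (law N) (map X ks)) (c' (law N) (law' N) (map X ks)) = g ks"
proof (rule ex_ex1I)
  define m where "m ks = (if ks = [] then 1 else
    \<Sum>\<pi>\<in>P (length ks). part_prod (\<lambda>ks. gbody (g ks)) \<pi> ks)" for ks
  define m' where "m' ks = (if ks = [] then 0 else
    \<Sum>\<pi>\<in>P (length ks). part_deriv (\<lambda>ks. gbody (g ks)) (\<lambda>ks. gsoul (g ks)) \<pi> ks)" for ks
  define N where "N = Abs_inf_law (ncext m, ncext m')"
  have "Rep_inf_law N = (ncext m, ncext m')"
    unfolding N_def by (rule Abs_inf_law_inverse) (simp add: linear_ncext ncext_one m_def m'_def)
  then have N: "law N = ncext m" "law' N = ncext m'" by (simp_all add: law_def law'_def)
  have b: "c (law N) (map X ks) = gbody (g ks)" if "ks \<noteq> []" for ks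
    using fin one part _ that
  proof (rule part_prod_unique)
    fix ks :: "'k list" assume "ks \<noteq> []"
    then show "(\<Sum>\<pi>\<in>P (length ks). part_prod (\<lambda>ks. c (law N) (map X ks)) \<pi> ks) =
        (\<Sum>\<pi>\<in>P (length ks). part_prod (\<lambda>ks. gbody (g ks)) \<pi> ks)"
      using c[of "map X ks" "law N"] by (simp add: N ncext_X part_prod_map m_def)
  qed
  have s: "c' (law N) (law' N) (map X ks) = gsoul (g ks)" if "ks \<noteq> []" for ks
    using fin one part b _ that
  proof (rule part_deriv_unique)
    fix ks :: "'k list" assume "ks \<noteq> []"
    then show "(\<Sum>\<pi>\<in>P (length ks). part_deriv (\<lambda>ks. c (law N) (map X ks))
          (\<lambda>ks. c' (law N) (law' N) (map X ks)) \<pi> ks) =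
        (\<Sum>\<pi>\<in>P (length ks). part_deriv (\<lambda>ks. gbody (g ks)) (\<lambda>ks. gsoul (g ks)) \<pi> ks)"
      using c'[of "map X ks" "law' N" "law N"] by (simp add: N ncext_X part_deriv_map m'_def)
  qed
  show "\<exists>N. \<forall>n\<ge>1. \<forall>ks. length ks = n \<longrightarrow>
      Grassmann (c (law N) (map X ks)) (c' (law N) (law' N) (map X ks)) = g ks"
  proof (intro exI allI impI)
    fix n :: nat and ks :: "'k list"
    assume "n \<ge> 1" "length ks = n"
    then have "ks \<noteq> []" by auto
    then show "Grassmann (c (law N) (map X ks)) (c' (law N) (law' N) (map X ks)) = g ks"
      by (simp add: b s)
  qed
next
  fix M N
  assume M: "\<forall>n\<ge>1. \<forall>ks. length ks = n \<longrightarrow>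
      Grassmann (c (law M) (map X ks)) (c' (law M) (law' M) (map X ks)) = g ks"
    and N: "\<forall>n\<ge>1. \<forall>ks. length ks = n \<longrightarrow>
      Grassmann (c (law N) (map X ks)) (c' (law N) (law' N) (map X ks)) = g ks"
  have eq: "c (law M) (map X ks) = c (law N) (map X ks)"
    "c' (law M) (law' M) (map X ks) = c' (law N) (law' N) (map X ks)" if "ks \<noteq> []" for ks
  proof -
    have "Grassmann (c (law M) (map X ks)) (c' (law M) (law' M) (map X ks)) =
        Grassmann (c (law N) (map X ks)) (c' (law N) (law' N) (map X ks))"
      using M N that by (metis One_nat_def Suc_leI length_greater_0_conv)
    then show "c (law M) (map X ks) = c (law N) (map X ks)"
      "c' (law M) (law' M) (map X ks) = c' (law N) (law' N) (map X ks)" by auto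
  qed
  have blk: "nths ks V \<noteq> []" if "\<pi> \<in> P (length ks)" "V \<in> \<pi>" for ks :: "'k list" and \<pi> V
    using that part nths_block_nonempty by blast
  show "M = N"
  proof (rule inf_law_eqI)
    fix ks :: "'k list" assume ks: "ks \<noteq> []"
    show "law M (prod_list (map X ks)) = law N (prod_list (map X ks))"
      using ks c[of "map X ks" "law M"] c[of "map X ks" "law N"]
      by (simp add: part_prod_map)
        (intro sum.cong part_prod_cong refl eq, erule (1) blk)
    show "law' M (prod_list (map X ks)) = law' N (prod_list (map X ks))"
      using ks c'[of "map X ks" "law' M" "law M"] c'[of "map X ks" "law' N" "law N"]
      by (simp add: part_deriv_map)
        (intro sum.cong part_deriv_cong refl eq; erule (1) blk)
  qed
qed


section \<open>Convolution powers and the Bercovici--Pata bijection\<close>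

text \<open>
  As in the definition of the convolution powers, cumulants of a law are regarded through their
  values on tuples of variables: for a list \<open>ks\<close> of length $n$, \<open>free_cumulantG M ks\<close> is
  $\tilde r_n(X_{k_1},\dots,X_{k_n})$.
\<close>

definition free_cumulantG :: "'k inf_law \<Rightarrow> 'k list \<Rightarrow> grassmann" where
  "free_cumulantG M ks =
     Grassmann (free_cumulant (law M) (map X ks)) (inf_free_cumulant (law M) (law' M) (map X ks))"

definition boolean_cumulantG :: "'k inf_law \<Rightarrow> 'k list \<Rightarrow> grassmann" where
  "boolean_cumulantG M ks =
     Grassmann (boolean_cumulant (law M) (map X ks))
       (inf_boolean_cumulant (law M) (law' M) (map X ks))"

lemma free_cumulantG_ex1:
  "\<exists>!N. \<forall>n\<ge>1. \<forall>ks. length ks = n \<longrightarrow> free_cumulantG N ks = g ks"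
  unfolding free_cumulantG_def
  by (rule cumulants_ex1[OF finite_NC one_block_NC partition_on_NC moment_free_cumulant
        inf_moment_free_cumulant])

lemma boolean_cumulantG_ex1:
  "\<exists>!N. \<forall>n\<ge>1. \<forall>ks. length ks = n \<longrightarrow> boolean_cumulantG N ks = g ks"
  unfolding boolean_cumulantG_def
  by (rule cumulants_ex1[OF finite_IP one_block_IP partition_on_IP moment_boolean_cumulant
        inf_moment_boolean_cumulant])

definition free_power :: "'k inf_law \<Rightarrow> real \<Rightarrow> 'k inf_law" where
  "free_power M s = (THE N. \<forall>n\<ge>1. \<forall>ks. length ks = n \<longrightarrow>
     free_cumulantG N ks = s *\<^sub>R free_cumulantG M ks)"

definition boolean_power :: "'k inf_law \<Rightarrow> real \<Rightarrow> 'k inf_law" where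
  "boolean_power M s = (THE N. \<forall>n\<ge>1. \<forall>ks. length ks = n \<longrightarrow>
     boolean_cumulantG N ks = s *\<^sub>R boolean_cumulantG M ks)"

definition BBP :: "'k inf_law \<Rightarrow> 'k inf_law" where
  "BBP M = (THE N. \<forall>n\<ge>1. \<forall>ks. length ks = n \<longrightarrow> free_cumulantG N ks = boolean_cumulantG M ks)"

definition BBP_semigroup :: "real \<Rightarrow> 'k inf_law \<Rightarrow> 'k inf_law" where
  "BBP_semigroup t M = boolean_power (free_power M (1 + t)) (1 / (1 + t))"

end

theory Submission
  imports Defs
begin

text \<open>
  Collect the moments and the cumulants of a law into non-commutative power series over the
  Grassmann algebra: $G$ for the moments, $R$ and $B$ for the free and Boolean cumulants.  Splitting
  a partition along its first block gives $G = 1 + BG$ and $BG = R(z_1G,\dots,z_kG)$.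
  Say that $H$ is the time-$t$ image of $f$ if $G = 1 + tHG$ and $HG = f(z_1G,\dots,z_kG)$ for some
  $G$, so that $B$ is the time-1 image of $R$.  If $H$ is the time-$t$ image of $f$ by means of $G$
  and $K$ is the time-$s$ image of $H$ by means of $G'$, then $K$ is the time-$(s+t)$ image of $f$
  by means of $G'\cdot G(z_1G',\dots,z_kG')$: these maps form a one-parameter group.  Rescaling shows
  that the Boolean cumulants of $\tilde{\mathbb{B}}_t(\tilde\mu)$ are the time-$(1+t)$ image of the
  free cumulants of $\tilde\mu$, hence the time-$t$ image of the Boolean cumulants of
  $\tilde\mu$, and both claims follow from the group law.
\<close>

section \<open>Non-commutative power series\<close>

text \<open>A series is encoded as its coefficient function on words, so every coefficient formula
  is a finite sum and identities can be proved by induction over words.\<close>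

definition series_one :: "'k list \<Rightarrow> 'a::comm_ring_1" where
  "series_one w = (if w = [] then 1 else 0)"

definition series_mult ::
  "('k list \<Rightarrow> 'a::comm_ring_1) \<Rightarrow> ('k list \<Rightarrow> 'a) \<Rightarrow> 'k list \<Rightarrow> 'a" (infixl "\<star>" 70) where
  "(f \<star> g) w = (\<Sum>j\<le>length w. f (take j w) * g (drop j w))"

text \<open>\<open>series_subst G f\<close> is $f(z_1G,\dots,z_kG)$, computed from the left derivatives of \<open>f\<close>.\<close>

function series_subst ::
  "('k list \<Rightarrow> 'a::comm_ring_1) \<Rightarrow> ('k list \<Rightarrow> 'a) \<Rightarrow> 'k list \<Rightarrow> 'a" where
  "series_subst G f [] = f []"
| "series_subst G f (i # w) =
     (\<Sum>j\<le>length w. G (take j w) * series_subst G (\<lambda>u. f (i # u)) (drop j w))"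
  by pat_completeness auto
termination
  by (relation "Wellfounded.measure (\<lambda>(G, f, w). length w)") auto

text \<open>With \<open>f_i\<close> the left derivative of \<open>f\<close> by the letter
  \<open>i\<close>, substitution is \<open>f(zG) = f [] + sum z_i G f_i(zG)\<close>. This
  coefficient form replaces the explicit sum in all later unfoldings.\<close>

lemma series_subst_Cons:
  "series_subst G f (i # w) = (G \<star> series_subst G (\<lambda>u. f (i # u))) w"
  by (simp add: series_mult_def)

declare series_subst.simps(2) [simp del]

section \<open>The algebra of series under the concatenation product\<close>

lemma series_mult_Nil [simp]: "(f \<star> g) [] = f [] * g []"
  by (simp add: series_mult_def)

text \<open>Leibniz rule for the left derivative by \<open>i\<close>: the cut before the first
  letter gives the term with \<open>f []\<close>, and every other cut leaves \<open>i\<close> in the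
  left factor.\<close>

lemma series_mult_Cons: "(f \<star> g) (i # w) = f [] * g (i # w) + ((\<lambda>u. f (i # u)) \<star> g) w"
  by (simp add: series_mult_def sum.atMost_Suc_shift del: sum.atMost_Suc)

lemma series_mult_add_left: "(\<lambda>w. f w + g w) \<star> h = (\<lambda>w. (f \<star> h) w + (g \<star> h) w)"
  by (auto simp: series_mult_def sum.distrib algebra_simps)

lemma series_mult_add_right: "h \<star> (\<lambda>w. f w + g w) = (\<lambda>w. (h \<star> f) w + (h \<star> g) w)"
  by (auto simp: series_mult_def sum.distrib algebra_simps)

lemma series_mult_scale_left: "(\<lambda>w. c * f w) \<star> h = (\<lambda>w. c * (f \<star> h) w)"
  by (auto simp: series_mult_def sum_distrib_left algebra_simps)

lemma series_mult_scale_right: "h \<star> (\<lambda>w. c * f w) = (\<lambda>w. c * (h \<star> f) w)"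
  by (auto simp: series_mult_def sum_distrib_left algebra_simps)

lemma series_mult_one_left [simp]: "series_one \<star> f = f"
proof
  fix w
  show "(series_one \<star> f) w = f w"
  proof (cases w)
    case (Cons i v)
    have "((\<lambda>u. series_one (i # u)) \<star> f) v = 0"
      by (simp add: series_mult_def series_one_def)
    then show ?thesis using Cons by (simp add: series_mult_Cons series_one_def)
  qed (simp add: series_one_def)
qed

text \<open>By the Leibniz rule both sides have the same left derivatives; \<open>f\<close> is
  generalized because the induction passes to its derivative.\<close>

lemma series_mult_assoc: "(f \<star> g) \<star> h = f \<star> (g \<star> h)"
proof
  fix w
  show "((f \<star> g) \<star> h) w = (f \<star> (g \<star> h)) w"
  proof (induction w arbitrary: f)
    case (Cons i w)
    have "((f \<star> g) \<star> h) (i # w) =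
        f [] * g [] * h (i # w) + ((\<lambda>u. f [] * g (i # u) + ((\<lambda>u. f (i # u)) \<star> g) u) \<star> h) w"
      by (simp add: series_mult_Cons)
    also have "\<dots> = (f \<star> (g \<star> h)) (i # w)"
      by (simp add: series_mult_Cons series_mult_add_left series_mult_scale_left Cons.IH
          algebra_simps)
    finally show ?case .
  qed (simp add: algebra_simps)
qed

lemma series_mult_cong_right:
  assumes "\<And>v. length v \<le> length w \<Longrightarrow> g v = g' v"
  shows "(f \<star> g) w = (f \<star> g') w"
  unfolding series_mult_def using assms by (intro sum.cong) auto

lemma series_mult_cong_both:
  assumes "\<And>v. length v \<le> length w \<Longrightarrow> f v = f' v" "\<And>v. length v \<le> length w \<Longrightarrow> g v = g' v"
  shows "(f \<star> g) w = (f' \<star> g') w"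
  unfolding series_mult_def using assms by (intro sum.cong) auto

text \<open>Since \<open>h [] = 1\<close>, the coefficient of \<open>f \<star> h\<close> at
  \<open>w\<close> is \<open>f w\<close> plus terms with \<open>f\<close> at proper prefixes of
  \<open>w\<close>, so coefficients are recovered by length.\<close>

lemma series_mult_right_cancel:
  assumes "f \<star> h = g \<star> h" "h [] = 1"
  shows "f = g"
proof
  fix w
  show "f w = g w"
  proof (induction w rule: length_induct)
    case (1 w)
    have *: "(k \<star> h) w = (\<Sum>j<length w. k (take j w) * h (drop j w)) + k w" for k
      using assms(2) by (simp add: series_mult_def lessThan_Suc_atMost[symmetric])
    have "(\<Sum>j<length w. f (take j w) * h (drop j w)) = (\<Sum>j<length w. g (take j w) * h (drop j w))"
      using 1 by (intro sum.cong) auto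
    then show ?case using *[of f] *[of g] assms(1) by simp
  qed
qed

section \<open>Substitution as an algebra homomorphism\<close>

lemma series_subst_add:
  "series_subst G (\<lambda>w. f w + g w) = (\<lambda>w. series_subst G f w + series_subst G g w)"
proof
  fix w
  show "series_subst G (\<lambda>w. f w + g w) w = series_subst G f w + series_subst G g w"
  \<comment> \<open>Length induction, because the recursion reaches every suffix of the tail, with
    the series replaced by their left derivatives.\<close>
  proof (induction w arbitrary: f g rule: length_induct)
    case (1 w)
    show ?case
    proof (cases w)
      case (Cons i v)
      have "(G \<star> series_subst G (\<lambda>u. f (i # u) + g (i # u))) v =
          (G \<star> (\<lambda>w. series_subst G (\<lambda>u. f (i # u)) w + series_subst G (\<lambda>u. g (i # u)) w)) v"
        using 1 Cons by (intro series_mult_cong_right) auto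
      then show ?thesis by (simp add: Cons series_subst_Cons series_mult_add_right)
    qed simp
  qed
qed

lemma series_subst_scale: "series_subst G (\<lambda>w. c * f w) = (\<lambda>w. c * series_subst G f w)"
proof
  fix w
  show "series_subst G (\<lambda>w. c * f w) w = c * series_subst G f w"
  proof (induction w arbitrary: f rule: length_induct)
    case (1 w)
    show ?case
    proof (cases w)
      case (Cons i v)
      have "(G \<star> series_subst G (\<lambda>u. c * f (i # u))) v =
          (G \<star> (\<lambda>w. c * series_subst G (\<lambda>u. f (i # u)) w)) v"
        using 1 Cons by (intro series_mult_cong_right) auto
      then show ?thesis by (simp add: Cons series_subst_Cons series_mult_scale_right)
    qed simp
  qed
qed

lemma series_subst_one: "series_subst G series_one = series_one"
proof
  fix w
  show "series_subst G series_one w = series_one w"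
  proof (cases w)
    case (Cons i v)
    \<comment> \<open>The left derivatives of \<open>series_one\<close> vanish; zero is written as a
      multiple by 0 so that linearity applies.\<close>
    have "series_subst G (\<lambda>u. 0 * f u) = (\<lambda>u. 0)" for f
      by (subst series_subst_scale) simp
    then show ?thesis by (simp add: Cons series_subst_Cons series_mult_def series_one_def)
  qed (simp add: series_one_def)
qed

lemma series_subst_by_one: "series_subst series_one f = f"
proof
  fix w
  show "series_subst series_one f w = f w"
    by (induction w arbitrary: f) (simp_all add: series_subst_Cons)
qed

text \<open>The Leibniz rule holds before and after substitution: the term with \<open>f []\<close>
  matches directly, and the term with the derivative of \<open>f\<close> is the induction hypothesis
  on a shorter word.\<close>

lemma series_subst_mult: "series_subst G (f \<star> g) = series_subst G f \<star> series_subst G g"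
proof
  fix w
  show "series_subst G (f \<star> g) w = (series_subst G f \<star> series_subst G g) w"
  proof (induction w arbitrary: f rule: length_induct)
    case (1 w)
    show ?case
    proof (cases w)
      case (Cons i v)
      let ?d = "\<lambda>f u. f (i # u)"
      have d: "?d (series_subst G f) = G \<star> series_subst G (?d f)" for f
        by (simp add: series_subst_Cons fun_eq_iff)
      have "series_subst G (f \<star> g) w = (G \<star> series_subst G (?d (f \<star> g))) v"
        by (simp add: Cons series_subst_Cons)
      also have "?d (f \<star> g) = (\<lambda>u. f [] * ?d g u + (?d f \<star> g) u)"
        by (simp add: series_mult_Cons)
      also have "(G \<star> series_subst G \<dots>) v =
          f [] * (G \<star> series_subst G (?d g)) v + (G \<star> series_subst G (?d f \<star> g)) v"
        by (simp add: series_subst_add series_subst_scale series_mult_add_right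
            series_mult_scale_right)
      also have "(G \<star> series_subst G (?d f \<star> g)) v =
          (G \<star> (series_subst G (?d f) \<star> series_subst G g)) v"
        using 1 Cons by (intro series_mult_cong_right) auto
      also have "f [] * (G \<star> series_subst G (?d g)) v + \<dots> = (series_subst G f \<star> series_subst G g) w"
        by (simp add: Cons series_mult_Cons d series_mult_assoc[symmetric] series_subst_Cons)
      finally show ?thesis .
    qed simp
  qed
qed

text \<open>Substituting \<open>z_i G'\<close> for \<open>z_i\<close> sends \<open>z_i G\<close> to
  \<open>z_i G' G(zG')\<close>, so the composite is a substitution of the same kind. This produces
  the group law below.\<close>

lemma series_subst_subst:
  "series_subst G' (series_subst G f) = series_subst (G' \<star> series_subst G' G) f"
proof
  fix w
  show "series_subst G' (series_subst G f) w = series_subst (G' \<star> series_subst G' G) f w"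
  proof (induction w arbitrary: f rule: length_induct)
    case (1 w)
    show ?case
    proof (cases w)
      case (Cons i v)
      let ?f = "\<lambda>u. f (i # u)"
      have "series_subst G' (series_subst G f) w = (G' \<star> series_subst G' (G \<star> series_subst G ?f)) v"
        by (simp add: Cons series_subst_Cons)
      also have "\<dots> = ((G' \<star> series_subst G' G) \<star> series_subst G' (series_subst G ?f)) v"
        by (simp add: series_subst_mult series_mult_assoc)
      also have "\<dots> = ((G' \<star> series_subst G' G) \<star> series_subst (G' \<star> series_subst G' G) ?f) v"
        using 1 Cons by (intro series_mult_cong_right) auto
      finally show ?thesis by (simp add: Cons series_subst_Cons)
    qed simp
  qed
qed

text \<open>Each factor \<open>z_i G\<close> uses up a letter of \<open>w\<close>, so
  \<open>G\<close> is evaluated only at strictly shorter words. Hence an equation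
  \<open>G = 1 + t f(zG)\<close> determines \<open>G\<close>.\<close>

lemma series_subst_cong_base:
  assumes "\<And>v. length v < length w \<Longrightarrow> G v = G' v"
  shows "series_subst G f w = series_subst G' f w"
  using assms
proof (induction w arbitrary: f rule: length_induct)
  case (1 w)
  show ?case
  proof (cases w)
    case (Cons i v)
    show ?thesis
      unfolding Cons series_subst_Cons using 1 [unfolded Cons] by (intro series_mult_cong_both) auto
  qed simp
qed


section \<open>The free-to-Boolean transform with parameter\<close>

text \<open>A relation rather than a function: uniqueness is proved for series, while existence is
  later read off from laws. At \<open>t = 1\<close> the witness \<open>G\<close> is the moment
  series. The condition \<open>f [] = 0\<close> forces \<open>G [] = 1\<close>, which makes
  \<open>G\<close> cancellable.\<close>

definition cumulant_flow ::
  "'a::comm_ring_1 \<Rightarrow> ('k list \<Rightarrow> 'a) \<Rightarrow> ('k list \<Rightarrow> 'a) \<Rightarrow> bool" where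
  "cumulant_flow t f H \<longleftrightarrow> f [] = 0 \<and>
     (\<exists>G. G = (\<lambda>w. series_one w + t * (H \<star> G) w) \<and> H \<star> G = series_subst G f)"

text \<open>At time 0 the first equation forces \<open>G = 1\<close>, and the second then identifies
  the image with \<open>f\<close>.\<close>

lemma cumulant_flow_zero: "f [] = 0 \<Longrightarrow> cumulant_flow 0 f f"
  unfolding cumulant_flow_def
proof (intro conjI exI[of _ series_one])
  show "f \<star> series_one = series_subst series_one f"
  proof
    fix w
    show "(f \<star> series_one) w = series_subst series_one f w"
      by (induction w arbitrary: f)
        (simp_all add: series_mult_Cons series_subst_by_one, simp_all add: series_one_def)
  qed
qed auto

text \<open>The same \<open>G\<close> serves both times: the factor \<open>c\<close> stays in
  \<open>G = 1 + c H G\<close> and cancels from \<open>c H G = c f(zG)\<close>.\<close>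

lemma cumulant_flow_scale:
  assumes "cumulant_flow 1 (\<lambda>w. c * f w) (\<lambda>w. c * H w)" "c * d = 1"
  shows "cumulant_flow c f H"
proof -
  \<comment> \<open>The coefficients lie in a ring with zero divisors, so cancellation goes through
    the inverse \<open>d\<close>.\<close>
  have cancel: "x = y" if "c * x = c * y" for x y
    using that assms(2) by (metis mult.assoc mult.commute mult_1)
  obtain G where "G = (\<lambda>w. series_one w + 1 * ((\<lambda>w. c * H w) \<star> G) w)"
    "(\<lambda>w. c * H w) \<star> G = series_subst G (\<lambda>w. c * f w)" and f: "c * f [] = 0"
    using assms(1) unfolding cumulant_flow_def by blast
  then have G: "G = (\<lambda>w. series_one w + c * (H \<star> G) w)"
    "c * (H \<star> G) w = c * series_subst G f w" for w
    unfolding series_mult_scale_left series_subst_scale by (simp, metis)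
  have "f [] = 0" using cancel[of "f []" 0] f by simp
  moreover have "H \<star> G = series_subst G f" using cancel G(2) by blast
  ultimately show ?thesis unfolding cumulant_flow_def using G(1) by blast
qed

lemma cumulant_flow_compose:
  assumes "cumulant_flow t f H" "cumulant_flow s H K"
  shows "cumulant_flow (s + t) f K"
proof -
  obtain G where G: "G = (\<lambda>w. series_one w + t * (H \<star> G) w)" "H \<star> G = series_subst G f"
    using assms(1) unfolding cumulant_flow_def by blast
  obtain G' where G': "G' = (\<lambda>w. series_one w + s * (K \<star> G') w)" "K \<star> G' = series_subst G' H"
    using assms(2) unfolding cumulant_flow_def by blast
  define A where "A = series_subst G' G"
  define G'' where "G'' = G' \<star> A"
  \<comment> \<open>Since \<open>K \<star> G'\<close> is \<open>H(zG')\<close>, multiplying on the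
    right by \<open>A\<close>, which is \<open>G(zG')\<close>, gives
    \<open>(H \<star> G)(zG')\<close> by multiplicativity.\<close>
  have KG'': "K \<star> G'' = series_subst G' (H \<star> G)"
    by (simp add: G''_def A_def series_subst_mult G'(2)[symmetric] series_mult_assoc)
  then have 1: "K \<star> G'' = series_subst G'' f"
    by (simp add: G(2) series_subst_subst G''_def A_def)
  have A: "A = (\<lambda>w. series_one w + t * (K \<star> G'') w)"
    unfolding KG'' A_def
    by (subst G(1)) (simp add: series_subst_add series_subst_scale series_subst_one)
  \<comment> \<open>Multiplying the equation of \<open>G'\<close> on the right by \<open>A\<close>
    contributes the time \<open>s\<close>; the equation of \<open>A\<close> contributes
    \<open>t\<close>.\<close>
  have "G'' = (\<lambda>w. A w + s * (K \<star> G'') w)"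
    unfolding G''_def
    by (subst G'(1)) (simp add: series_mult_add_left series_mult_scale_left series_mult_assoc)
  then have "G'' = (\<lambda>w. series_one w + (s + t) * (K \<star> G'') w)"
    by (subst (asm) A) (simp add: algebra_simps)
  with 1 assms(1) show ?thesis unfolding cumulant_flow_def by blast
qed

text \<open>Eliminating \<open>H\<close> leaves \<open>G = 1 + t f(zG)\<close>, which fixes
  \<open>G\<close> by induction on length; \<open>G [] = 1\<close> then allows \<open>G\<close> to
  be cancelled from \<open>H \<star> G\<close>.\<close>

lemma cumulant_flow_unique:
  assumes "cumulant_flow t f H" "cumulant_flow t f H'"
  shows "H = H'"
proof -
  obtain G where G: "G = (\<lambda>w. series_one w + t * (H \<star> G) w)" "H \<star> G = series_subst G f"
    using assms(1) unfolding cumulant_flow_def by blast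
  obtain G' where G': "G' = (\<lambda>w. series_one w + t * (H' \<star> G') w)" "H' \<star> G' = series_subst G' f"
    using assms(2) unfolding cumulant_flow_def by blast
  have eqs: "G w = series_one w + t * series_subst G f w"
    "G' w = series_one w + t * series_subst G' f w" for w
    using fun_cong[OF G(1)] fun_cong[OF G'(1)] unfolding G(2) G'(2) by auto
  have "G w = G' w" for w
  proof (induction w rule: length_induct)
    case (1 w)
    then show ?case using series_subst_cong_base[of w G G' f] eqs[of w] by simp
  qed
  then have "G = G'" by blast
  moreover have "G [] = 1"
    using eqs(1)[of "[]"] assms(1) by (simp add: cumulant_flow_def series_one_def)
  ultimately show ?thesis using G(2) G'(2) series_mult_right_cancel by metis
qed

section \<open>Recursions for sums over partitions\<close>

abbreviation slice :: "'a list \<Rightarrow> nat \<Rightarrow> nat \<Rightarrow> 'a list" where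
  "slice w a b \<equiv> take (b - a) (drop a w)"

lemma slice_Cons:
  assumes "a < b" "b \<le> length w"
  shows "slice w a b = w ! a # slice w (Suc a) b"
proof -
  have "drop a w = w ! a # drop (Suc a) w" using assms by (intro Cons_nth_drop_Suc[symmetric]) simp
  moreover have "b - a = Suc (b - Suc a)" using assms by simp
  ultimately show ?thesis by simp
qed

text \<open>Prefix lengths become absolute cut positions, the form in which sums over partitions of
  intervals produce products.\<close>

lemma series_mult_slice:
  assumes "c \<le> b" "b \<le> length w"
  shows "(f \<star> g) (slice w c b) = (\<Sum>d\<in>{c..b}. f (slice w c d) * g (slice w d b))"
  unfolding series_mult_def
proof (rule sum.reindex_bij_witness[of _ "\<lambda>d. d - c" "\<lambda>j. c + j"], goal_cases)
  case (5 j)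
  then have "j \<le> b - c" using assms by simp
  then show ?case using assms by (simp add: drop_take add.commute)
qed (use assms in auto)

text \<open>Every position in \<open>V\<close> precedes \<open>d\<close>, so the new letter comes
  last; this is how a block under construction grows.\<close>

lemma nths_insert_above:
  assumes "V \<subseteq> {..<d}" "d < length w"
  shows "nths w (insert d V) = nths w V @ [w ! d]"
proof -
  have w: "w = take d w @ w ! d # drop (Suc d) w"
    using assms by (simp add: id_take_nth_drop[symmetric])
  have "nths w (insert d V) = nths (take d w @ w ! d # drop (Suc d) w) (insert d V)"
    using w by simp
  also have "\<dots> = nths (take d w) (insert d V) @ [w ! d] @ nths (drop (Suc d) w) {j. Suc (j + d) \<in> insert d V}"
    using assms by (simp add: nths_append nths_Cons)
  also have "{j. Suc (j + d) \<in> insert d V} = {}" using assms by auto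
  also have "nths (take d w) (insert d V) = nths (take d w) V"
    unfolding nths_def using assms
    by (intro arg_cong[of _ _ "map fst"] filter_cong) (auto dest!: set_zip_rightD)
  finally have 1: "nths w (insert d V) = nths (take d w) V @ [w ! d]" by simp
  have "nths w V = nths (take d w @ w ! d # drop (Suc d) w) V"
    using w by simp
  also have "\<dots> = nths (take d w) V @ nths (drop (Suc d) w) {j. Suc (j + d) \<in> V}"
    using assms by (auto simp add: nths_append nths_Cons)
  also have "{j. Suc (j + d) \<in> V} = {}" using assms by auto
  finally show ?thesis using 1 by simp
qed

lemma nths_interval:
  assumes "a \<le> b" "b \<le> length w"
  shows "nths w {a..<b} = slice w a b"
  using assms
proof (induction b rule: dec_induct)
  case (step n)
  have "{a..<Suc n} = insert n {a..<n}" using step by auto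
  moreover have "slice w a (Suc n) = slice w a n @ [w ! n]"
    using step by (simp add: Suc_diff_le take_Suc_conv_app_nth)
  moreover have "nths w (insert n {a..<n}) = nths w {a..<n} @ [w ! n]"
    using step by (intro nths_insert_above) auto
  ultimately show ?case using step by simp
qed simp

section \<open>Non-crossing partitions, built up one block at a time\<close>

definition noncrossing :: "nat set set \<Rightarrow> bool" where
  "noncrossing \<pi> \<longleftrightarrow> \<not> (\<exists>V\<in>\<pi>. \<exists>W\<in>\<pi>. V \<noteq> W \<and>
     (\<exists>a\<in>V. \<exists>b\<in>W. \<exists>c\<in>V. \<exists>d\<in>W. a < b \<and> b < c \<and> c < d))"

lemma noncrossingD:
  assumes "noncrossing \<pi>" "V \<in> \<pi>" "W \<in> \<pi>" "a \<in> V" "b \<in> W" "c \<in> V" "d \<in> W"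
    "a < b" "b < c" "c < d"
  shows "V = W"
  using assms unfolding noncrossing_def by metis

lemma noncrossing_subset: "noncrossing \<pi> \<Longrightarrow> \<rho> \<subseteq> \<pi> \<Longrightarrow> noncrossing \<rho>"
  unfolding noncrossing_def by (meson subsetD)

text \<open>Arbitrary ground sets are allowed because the recursion also meets sets consisting of a
  partial block and a later interval.\<close>

definition nc_partitions :: "nat set \<Rightarrow> nat set set set" where
  "nc_partitions A = {\<pi>. partition_on A \<pi> \<and> noncrossing \<pi>}"

lemma NC_eq_nc_partitions: "NC n = nc_partitions {..<n}"
  by (simp add: NC_def nc_partitions_def noncrossing_def)

lemma finite_nc_partitions: "finite A \<Longrightarrow> finite (nc_partitions A)"
  by (rule finite_subset[OF _ finitely_many_partition_on[of A]]) (auto simp: nc_partitions_def)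

lemma nc_partitions_empty: "nc_partitions {} = {{}}"
  by (auto simp: nc_partitions_def noncrossing_def partition_on_empty)

lemma partition_on_Un_disjoint:
  assumes "partition_on A \<rho>" "partition_on B \<sigma>" "A \<inter> B = {}"
  shows "partition_on (A \<union> B) (\<rho> \<union> \<sigma>)"
proof -
  have "disjoint (\<rho> \<union> \<sigma>)"
    using assms by (intro disjoint_union) (auto simp: partition_on_def)
  then show ?thesis using assms by (auto simp: partition_on_def)
qed

lemma partition_on_sub_blocks:
  assumes "partition_on (A \<union> B) \<pi>" "A \<inter> B = {}" "\<And>W. W \<in> \<pi> \<Longrightarrow> W \<subseteq> A \<or> W \<subseteq> B"
  shows "partition_on A {W\<in>\<pi>. W \<subseteq> A}"
proof (rule partition_onI)
  have "x \<in> \<Union>{W \<in> \<pi>. W \<subseteq> A}" if x: "x \<in> A" for x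
  proof -
    have "x \<in> \<Union>\<pi>" using assms(1) x by (auto simp: partition_on_def)
    then obtain W where W: "W \<in> \<pi>" "x \<in> W" by blast
    then have "W \<subseteq> A" using assms(2) assms(3)[OF W(1)] x by blast
    then show ?thesis using W by blast
  qed
  then show "\<Union>{W \<in> \<pi>. W \<subseteq> A} = A" by auto
qed (use assms(1) in \<open>auto simp: partition_on_def disjoint_def disjnt_def\<close>)

text \<open>In a crossing of a block inside \<open>I\<close> with one inside \<open>C\<close>, the
  alternation places an element of \<open>C\<close> between two elements of \<open>I\<close>,
  against convexity.\<close>

lemma noncrossing_Un:
  assumes "partition_on I \<rho>" "noncrossing \<rho>" "partition_on C \<sigma>" "noncrossing \<sigma>"
    and convex: "\<And>x y z. x \<in> I \<Longrightarrow> z \<in> I \<Longrightarrow> y \<in> C \<Longrightarrow> \<not> (x < y \<and> y < z)"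
  shows "noncrossing (\<rho> \<union> \<sigma>)"
  unfolding noncrossing_def
proof
  assume "\<exists>V\<in>\<rho> \<union> \<sigma>. \<exists>W\<in>\<rho> \<union> \<sigma>. V \<noteq> W \<and>
     (\<exists>a\<in>V. \<exists>b\<in>W. \<exists>c\<in>V. \<exists>d\<in>W. a < b \<and> b < c \<and> c < d)"
  then obtain V W a b c d where VW: "V \<in> \<rho> \<union> \<sigma>" "W \<in> \<rho> \<union> \<sigma>" "V \<noteq> W"
    and abcd: "a \<in> V" "b \<in> W" "c \<in> V" "d \<in> W" "a < b" "b < c" "c < d" by blast
  have sub: "U \<in> \<rho> \<Longrightarrow> U \<subseteq> I" "U \<in> \<sigma> \<Longrightarrow> U \<subseteq> C" for U
    using assms(1,3) by (auto simp: partition_on_def)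
  consider "V \<in> \<rho>" "W \<in> \<rho>" | "V \<in> \<sigma>" "W \<in> \<sigma>" | "V \<in> \<rho>" "W \<in> \<sigma>" | "V \<in> \<sigma>" "W \<in> \<rho>"
    using VW by blast
  then show False
  proof cases
    case 1
    then show False using noncrossingD[OF assms(2) _ _ abcd] VW(3) by blast
  next
    case 2
    then show False using noncrossingD[OF assms(4) _ _ abcd] VW(3) by blast
  next
    case 3
    then show False using convex[of a c b] abcd sub(1)[of V] sub(2)[of W] by blast
  next
    case 4
    then show False using convex[of b d c] abcd sub(1)[of W] sub(2)[of V] by blast
  qed
qed

text \<open>
  In all uses \<open>U\<close> is an initial segment of the block under construction and \<open>I\<close> the gap
  following it.
\<close>

lemma bij_betw_nc_partitions_gap:
  assumes "I \<inter> C = {}" "U \<subseteq> C" "U \<noteq> {}"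
    and convex: "\<And>x y z. x \<in> I \<Longrightarrow> z \<in> I \<Longrightarrow> y \<in> C \<Longrightarrow> \<not> (x < y \<and> y < z)"
    and gap: "\<And>x y. x \<in> I \<Longrightarrow> y \<in> C - U \<Longrightarrow> \<exists>u\<in>U. \<exists>v\<in>U. u < x \<and> x < v \<and> v < y"
  shows "bij_betw (\<lambda>(\<rho>, \<sigma>). \<rho> \<union> \<sigma>)
    (nc_partitions I \<times> {\<sigma>\<in>nc_partitions C. \<exists>B\<in>\<sigma>. U \<subseteq> B})
    {\<pi>\<in>nc_partitions (I \<union> C). \<exists>B\<in>\<pi>. U \<subseteq> B \<and> B \<inter> I = {}}" (is "bij_betw ?f ?S ?T")
\<comment> \<open>The inverse map sorts the blocks by the side on which they lie.\<close>
proof (rule bij_betw_byWitness[where f' = "\<lambda>\<pi>. ({W\<in>\<pi>. W \<subseteq> I}, {W\<in>\<pi>. W \<subseteq> C})"])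
  have ne: "W \<noteq> {}" if "W \<in> \<pi>" "\<pi> \<in> nc_partitions A" for W \<pi> A
    using that by (auto simp: nc_partitions_def partition_on_def)
  have sub: "W \<subseteq> A" if "W \<in> \<pi>" "\<pi> \<in> nc_partitions A" for W \<pi> A
    using that by (auto simp: nc_partitions_def partition_on_def)
  \<comment> \<open>A block \<open>W\<close> with \<open>x\<close> in \<open>I\<close> and
    \<open>y\<close> in \<open>C\<close> differs from \<open>B\<close>, so \<open>y\<close> is not
    in \<open>U\<close>; the gap hypothesis then yields \<open>u < x < v < y\<close> with
    \<open>u\<close>, \<open>v\<close> in \<open>B\<close>, a crossing.\<close>
  have dich: "W \<subseteq> I \<or> W \<subseteq> C" if \<pi>: "\<pi> \<in> ?T" and W: "W \<in> \<pi>" for \<pi> W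
  proof (rule ccontr)
    assume "\<not> (W \<subseteq> I \<or> W \<subseteq> C)"
    then obtain x y where xy: "x \<in> W" "x \<in> I" "y \<in> W" "y \<in> C" using sub[OF W, of "I \<union> C"] \<pi> by blast
    obtain B where B: "B \<in> \<pi>" "U \<subseteq> B" "B \<inter> I = {}" using \<pi> by blast
    have "B \<noteq> W" using B xy by blast
    moreover have "disjoint \<pi>" using \<pi> by (simp add: nc_partitions_def partition_on_def)
    ultimately have "B \<inter> W = {}" using B(1) W by (auto simp: disjoint_def)
    then have "y \<in> C - U" using B xy by blast
    then obtain u v where uv: "u \<in> U" "v \<in> U" "u < x" "x < v" "v < y" using gap xy(2) by blast
    have "noncrossing \<pi>" using \<pi> by (simp add: nc_partitions_def)
    moreover have "u \<in> B" "v \<in> B" using uv B by blast+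
    ultimately show False
      using noncrossingD[of \<pi> B W u x v y] xy B W uv \<open>B \<noteq> W\<close> by blast
  qed
  show "\<forall>a\<in>?S. ({W \<in> ?f a. W \<subseteq> I}, {W \<in> ?f a. W \<subseteq> C}) = a"
  proof
    fix a assume "a \<in> ?S"
    then obtain \<rho> \<sigma> where a: "a = (\<rho>, \<sigma>)" "\<rho> \<in> nc_partitions I" "\<sigma> \<in> nc_partitions C" by blast
    have "W \<subseteq> I \<and> \<not> W \<subseteq> C" if "W \<in> \<rho>" for W
      using ne[OF that a(2)] sub[OF that a(2)] assms(1) by blast
    moreover have "W \<subseteq> C \<and> \<not> W \<subseteq> I" if "W \<in> \<sigma>" for W
      using ne[OF that a(3)] sub[OF that a(3)] assms(1) by blast
    ultimately have "{W \<in> \<rho> \<union> \<sigma>. W \<subseteq> I} = \<rho>" "{W \<in> \<rho> \<union> \<sigma>. W \<subseteq> C} = \<sigma>"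
      by auto
    then show "({W \<in> ?f a. W \<subseteq> I}, {W \<in> ?f a. W \<subseteq> C}) = a" using a(1) by simp
  qed
  show "\<forall>\<pi>\<in>?T. ?f ({W \<in> \<pi>. W \<subseteq> I}, {W \<in> \<pi>. W \<subseteq> C}) = \<pi>" using dich by blast
  show "?f ` ?S \<subseteq> ?T"
  proof clarify
    fix \<rho> \<sigma> B assume \<rho>: "\<rho> \<in> nc_partitions I" and \<sigma>: "\<sigma> \<in> nc_partitions C" and B: "B \<in> \<sigma>" "U \<subseteq> B"
    have "partition_on I \<rho>" "noncrossing \<rho>" "partition_on C \<sigma>" "noncrossing \<sigma>"
      using \<rho> \<sigma> by (simp_all add: nc_partitions_def)
    then have "noncrossing (\<rho> \<union> \<sigma>)"
      using convex by (rule noncrossing_Un)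
    then have "\<rho> \<union> \<sigma> \<in> nc_partitions (I \<union> C)"
      using \<rho> \<sigma> partition_on_Un_disjoint[OF _ _ assms(1)] by (simp add: nc_partitions_def)
    moreover have "B \<inter> I = {}" using sub[OF B(1) \<sigma>] assms(1) by blast
    ultimately show "\<rho> \<union> \<sigma> \<in> nc_partitions (I \<union> C) \<and> (\<exists>B\<in>\<rho> \<union> \<sigma>. U \<subseteq> B \<and> B \<inter> I = {})"
      using B by blast
  qed
  show "(\<lambda>\<pi>. ({W \<in> \<pi>. W \<subseteq> I}, {W \<in> \<pi>. W \<subseteq> C})) ` ?T \<subseteq> ?S"
  proof (rule image_subsetI)
    fix \<pi> assume \<pi>: "\<pi> \<in> ?T"
    then obtain B where B: "B \<in> \<pi>" "U \<subseteq> B" "B \<inter> I = {}" by blast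
    have "B \<subseteq> C" using dich[OF \<pi> B(1)] B(2,3) assms(2,3) by blast
    then have B': "B \<in> {W \<in> \<pi>. W \<subseteq> C}" using B(1) by simp
    have part: "partition_on (I \<union> C) \<pi>" using \<pi> by (simp add: nc_partitions_def)
    have "partition_on I {W \<in> \<pi>. W \<subseteq> I}"
      using part assms(1) dich[OF \<pi>] by (rule partition_on_sub_blocks)
    moreover have "partition_on C {W \<in> \<pi>. W \<subseteq> C}"
    proof (rule partition_on_sub_blocks[of C I])
      show "partition_on (C \<union> I) \<pi>" "C \<inter> I = {}" using part assms(1) by (simp_all add: ac_simps)
      show "W \<subseteq> C \<or> W \<subseteq> I" if "W \<in> \<pi>" for W using dich[OF \<pi> that] by blast
    qed
    moreover have "noncrossing {W \<in> \<pi>. W \<subseteq> I}" "noncrossing {W \<in> \<pi>. W \<subseteq> C}"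
      using \<pi> by (auto simp: nc_partitions_def intro: noncrossing_subset)
    moreover have "\<exists>B\<in>{W \<in> \<pi>. W \<subseteq> C}. U \<subseteq> B" using B' B(2) by blast
    ultimately show "({W \<in> \<pi>. W \<subseteq> I}, {W \<in> \<pi>. W \<subseteq> C}) \<in> ?S"
      by (simp add: nc_partitions_def)
  qed
qed

text \<open>Block weights multiply over the union of the two partitions, so the bijection with a
  product set factors the sum.\<close>

lemma sum_nc_partitions_gap:
  fixes h :: "nat set \<Rightarrow> 'a::comm_ring_1"
  assumes "finite I" "finite C" "I \<inter> C = {}" "U \<subseteq> C" "U \<noteq> {}"
    and "\<And>x y z. x \<in> I \<Longrightarrow> z \<in> I \<Longrightarrow> y \<in> C \<Longrightarrow> \<not> (x < y \<and> y < z)"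
    and "\<And>x y. x \<in> I \<Longrightarrow> y \<in> C - U \<Longrightarrow> \<exists>u\<in>U. \<exists>v\<in>U. u < x \<and> x < v \<and> v < y"
  shows "(\<Sum>\<pi> | \<pi> \<in> nc_partitions (I \<union> C) \<and> (\<exists>B\<in>\<pi>. U \<subseteq> B \<and> B \<inter> I = {}). \<Prod>V\<in>\<pi>. h V) =
    (\<Sum>\<pi>\<in>nc_partitions I. \<Prod>V\<in>\<pi>. h V) *
    (\<Sum>\<pi> | \<pi> \<in> nc_partitions C \<and> (\<exists>B\<in>\<pi>. U \<subseteq> B). \<Prod>V\<in>\<pi>. h V)"
proof -
  have prod: "(\<Prod>V\<in>\<rho> \<union> \<sigma>. h V) = (\<Prod>V\<in>\<rho>. h V) * (\<Prod>V\<in>\<sigma>. h V)"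
    if "\<rho> \<in> nc_partitions I" "\<sigma> \<in> nc_partitions C" for \<rho> \<sigma>
  proof (rule prod.union_disjoint)
    show "finite \<rho>" "finite \<sigma>"
      using that assms(1,2) finite_elements by (auto simp: nc_partitions_def)
    have "\<forall>W\<in>\<rho>. W \<noteq> {} \<and> W \<subseteq> I" "\<forall>W\<in>\<sigma>. W \<subseteq> C"
      using that by (auto simp: nc_partitions_def partition_on_def)
    then show "\<rho> \<inter> \<sigma> = {}" using assms(3) by blast
  qed
  have "bij_betw (\<lambda>(\<rho>, \<sigma>). \<rho> \<union> \<sigma>)
      (nc_partitions I \<times> {\<sigma>\<in>nc_partitions C. \<exists>B\<in>\<sigma>. U \<subseteq> B})
      {\<pi>\<in>nc_partitions (I \<union> C). \<exists>B\<in>\<pi>. U \<subseteq> B \<and> B \<inter> I = {}}"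
    by (rule bij_betw_nc_partitions_gap) (fact assms)+
  then show ?thesis
    unfolding sum_product sum.cartesian_product
    by (subst sum.reindex_bij_betw[symmetric]) (auto intro!: sum.cong simp: prod)
qed

text \<open>The partitions are classified by the next element \<open>d\<close> of the block
  containing \<open>V0\<close>, with \<open>d = b\<close> if there is none; the gap before
  \<open>d\<close> is partitioned on its own. The intersection with \<open>{..<b}\<close> makes
  \<open>{d}\<close> empty in the case \<open>d = b\<close>.\<close>

lemma sum_nc_partitions_next:
  fixes h :: "nat set \<Rightarrow> 'a::comm_ring_1"
  assumes "V0 \<noteq> {}" "V0 \<subseteq> {..<c}" "c \<le> b"
  shows "(\<Sum>\<pi> | \<pi> \<in> nc_partitions (V0 \<union> {c..<b}) \<and> (\<exists>B\<in>\<pi>. V0 \<subseteq> B). \<Prod>V\<in>\<pi>. h V) =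
    (\<Sum>d\<in>{c..b}. (\<Sum>\<pi>\<in>nc_partitions {c..<d}. \<Prod>V\<in>\<pi>. h V) *
       (\<Sum>\<pi> | \<pi> \<in> nc_partitions (V0 \<union> {d..<b}) \<and> (\<exists>B\<in>\<pi>. V0 \<union> ({d} \<inter> {..<b}) \<subseteq> B).
          \<Prod>V\<in>\<pi>. h V))"
proof -
  define X where "X d = {\<pi>\<in>nc_partitions ({c..<d} \<union> (V0 \<union> {d..<b})).
    \<exists>B\<in>\<pi>. V0 \<union> ({d} \<inter> {..<b}) \<subseteq> B \<and> B \<inter> {c..<d} = {}}" for d
  let ?A = "V0 \<union> {c..<b}"
  have fin: "finite V0" using assms(2) finite_subset by blast
  have A: "{c..<d} \<union> (V0 \<union> {d..<b}) = ?A" if "d \<in> {c..b}" for d using that by auto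
  have "{\<pi>\<in>nc_partitions ?A. \<exists>B\<in>\<pi>. V0 \<subseteq> B} = (\<Union>d\<in>{c..b}. X d)"
  proof (intro equalityI subsetI)
    fix \<pi> assume "\<pi> \<in> {\<pi>\<in>nc_partitions ?A. \<exists>B\<in>\<pi>. V0 \<subseteq> B}"
    then obtain B where \<pi>: "\<pi> \<in> nc_partitions ?A" and B: "B \<in> \<pi>" "V0 \<subseteq> B" by blast
    \<comment> \<open>Inserting \<open>b\<close> guarantees that the minimum exists when the block
      has no element from \<open>c\<close> on.\<close>
    define d where "d = (LEAST d. d \<ge> c \<and> d \<in> insert b B)"
    have d: "d \<ge> c \<and> d \<in> insert b B" unfolding d_def by (rule LeastI[of _ b]) (use assms in auto)
    have least: "d \<le> e" if "e \<ge> c" "e \<in> insert b B" for e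
      unfolding d_def using that by (intro Least_le) auto
    have "d \<le> b" using least[of b] assms by simp
    moreover have "B \<inter> {c..<d} = {}" using least by fastforce
    moreover have "V0 \<union> ({d} \<inter> {..<b}) \<subseteq> B" using B d by auto
    ultimately have "\<pi> \<in> X d" using B(1) \<pi> d A[of d] unfolding X_def by auto
    then show "\<pi> \<in> (\<Union>d\<in>{c..b}. X d)" using d \<open>d \<le> b\<close> by auto
  next
    fix \<pi> assume "\<pi> \<in> (\<Union>d\<in>{c..b}. X d)"
    then show "\<pi> \<in> {\<pi>\<in>nc_partitions ?A. \<exists>B\<in>\<pi>. V0 \<subseteq> B}"
      using A unfolding X_def by fastforce
  qed
  then have "(\<Sum>\<pi> | \<pi> \<in> nc_partitions ?A \<and> (\<exists>B\<in>\<pi>. V0 \<subseteq> B). \<Prod>V\<in>\<pi>. h V) =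
      (\<Sum>\<pi>\<in>(\<Union>d\<in>{c..b}. X d). \<Prod>V\<in>\<pi>. h V)" by simp
  also have "\<dots> = (\<Sum>d\<in>{c..b}. \<Sum>\<pi>\<in>X d. \<Prod>V\<in>\<pi>. h V)"
  proof (rule sum.UNION_disjoint)
    show "\<forall>d\<in>{c..b}. finite (X d)"
      unfolding X_def using fin by (auto intro!: finite_nc_partitions)
    \<comment> \<open>Both conditions concern the block containing \<open>V0\<close>: it would
      contain \<open>d\<close> and yet avoid \<open>{c..<e}\<close>.\<close>
    have "X d \<inter> X e = {}" if "d < e" "d \<in> {c..b}" "e \<in> {c..b}" for d e
    proof (rule ccontr)
      assume "X d \<inter> X e \<noteq> {}"
      then obtain \<pi> where \<pi>: "\<pi> \<in> X d" "\<pi> \<in> X e" by blast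
      obtain B where B: "B \<in> \<pi>" "V0 \<union> ({d} \<inter> {..<b}) \<subseteq> B"
        using \<pi>(1) unfolding X_def by blast
      obtain B' where B': "B' \<in> \<pi>" "V0 \<union> ({e} \<inter> {..<b}) \<subseteq> B'" "B' \<inter> {c..<e} = {}"
        using \<pi>(2) unfolding X_def by blast
      have "disjoint \<pi>" using \<pi>(1) by (simp add: X_def nc_partitions_def partition_on_def)
      moreover have "B \<inter> B' \<noteq> {}" using B(2) B'(2) assms(1) by blast
      ultimately have "B = B'" using B(1) B'(1) disjointD by blast
      moreover have "d \<in> B" "d \<in> {c..<e}" using B(2) that by auto
      ultimately show False using B'(3) by blast
    qed
    then show "\<forall>d\<in>{c..b}. \<forall>e\<in>{c..b}. d \<noteq> e \<longrightarrow> X d \<inter> X e = {}"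
      by (metis Int_commute linorder_neq_iff)
  qed simp
  also have "\<dots> = (\<Sum>d\<in>{c..b}. (\<Sum>\<pi>\<in>nc_partitions {c..<d}. \<Prod>V\<in>\<pi>. h V) *
       (\<Sum>\<pi> | \<pi> \<in> nc_partitions (V0 \<union> {d..<b}) \<and> (\<exists>B\<in>\<pi>. V0 \<union> ({d} \<inter> {..<b}) \<subseteq> B).
          \<Prod>V\<in>\<pi>. h V))"
    unfolding X_def
  proof (intro sum.cong[OF refl] sum_nc_partitions_gap)
    fix d x y assume x: "x \<in> {c..<d}" and y: "y \<in> V0 \<union> {d..<b} - (V0 \<union> {d} \<inter> {..<b})"
    obtain u where u: "u \<in> V0" "u < x" using assms x by fastforce
    \<comment> \<open>An element of \<open>V0\<close> lies before the gap, and \<open>d\<close> lies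
      between the gap and \<open>y\<close>.\<close>
    show "\<exists>u\<in>V0 \<union> {d} \<inter> {..<b}. \<exists>v\<in>V0 \<union> {d} \<inter> {..<b}. u < x \<and> x < v \<and> v < y"
      using u x y by (intro bexI[of _ u] bexI[of _ d]) auto
  qed (use assms fin in auto)
  finally show ?thesis .
qed

text \<open>
  The word \<open>u\<close> consists of the letters read so far of the block under construction.  The moment
  series is \<open>nc_series f []\<close>, provided that \<open>f [] = 1\<close>.
\<close>

function nc_series :: "('k list \<Rightarrow> 'a::comm_ring_1) \<Rightarrow> 'k list \<Rightarrow> 'k list \<Rightarrow> 'a" where
  "nc_series f u [] = f u"
| "nc_series f u (i # w) =
     (\<Sum>j\<le>length w. nc_series f [] (take j w) * nc_series f (u @ [i]) (drop j w))"
  by pat_completeness auto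
termination
  by (relation "Wellfounded.measure (\<lambda>(f, u, w). length w)") auto

lemma nc_series_Cons: "nc_series f u (i # w) = (nc_series f [] \<star> nc_series f (u @ [i])) w"
  by (simp add: series_mult_def)

declare nc_series.simps(2) [simp del]

text \<open>Both recursions read one letter, then a gap, then the rest. For \<open>u = []\<close>
  this is the functional equation between moments and free cumulants.\<close>

lemma nc_series_eq_subst: "nc_series f u = series_subst (nc_series f []) (\<lambda>v. f (u @ v))"
proof
  fix w
  show "nc_series f u w = series_subst (nc_series f []) (\<lambda>v. f (u @ v)) w"
  proof (induction w arbitrary: u rule: length_induct)
    case (1 w)
    show ?case
    proof (cases w)
      case (Cons i v)
      show ?thesis
        unfolding Cons nc_series_Cons series_subst_Cons
        using 1 [unfolded Cons] by (intro series_mult_cong_right) auto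
    qed simp
  qed
qed

text \<open>Simultaneous induction on the length of the interval: the first claim opens a block at
  \<open>c\<close> and uses the second; the second chooses the next element of the block and uses
  both. The value \<open>f [] = 1\<close> is the weight of the empty partition.\<close>

lemma sum_nc_partitions_interval:
  fixes f :: "'k list \<Rightarrow> 'a::comm_ring_1"
  assumes "f [] = 1"
  shows "\<And>c b. b - c = n \<Longrightarrow> c \<le> b \<Longrightarrow> b \<le> length w \<Longrightarrow>
      (\<Sum>\<pi>\<in>nc_partitions {c..<b}. \<Prod>V\<in>\<pi>. f (nths w V)) = nc_series f [] (slice w c b)"
    and "\<And>c b V0. b - c = n \<Longrightarrow> c \<le> b \<Longrightarrow> b \<le> length w \<Longrightarrow> V0 \<noteq> {} \<Longrightarrow> V0 \<subseteq> {..<c} \<Longrightarrow>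
      (\<Sum>\<pi> | \<pi> \<in> nc_partitions (V0 \<union> {c..<b}) \<and> (\<exists>B\<in>\<pi>. V0 \<subseteq> B). \<Prod>V\<in>\<pi>. f (nths w V)) =
      (nc_series f [] \<star> nc_series f (nths w V0)) (slice w c b)"
proof (induction n rule: less_induct)
  case (less n)
  {
    case 1
    show ?case
    proof (cases "c < b")
      case False
      then show ?thesis using 1 assms by (simp add: nc_partitions_empty)
    next
      case True
      have "nc_partitions {c..<b} =
          {\<pi>\<in>nc_partitions ({c} \<union> {Suc c..<b}). \<exists>B\<in>\<pi>. {c} \<subseteq> B}"
      proof -
        have "{c} \<union> {Suc c..<b} = {c..<b}" using True by auto
        moreover have "\<exists>B\<in>\<pi>. {c} \<subseteq> B" if "\<pi> \<in> nc_partitions {c..<b}" for \<pi>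
        proof -
          have "c \<in> \<Union>\<pi>" using that True by (auto simp: nc_partitions_def partition_on_def)
          then show ?thesis by blast
        qed
        ultimately show ?thesis by auto
      qed
      moreover have "nths w {c} = [w ! c]" using nths_insert_above[of "{}" c w] True 1 by simp
      moreover have "slice w c b = w ! c # slice w (Suc c) b" using True 1 by (intro slice_Cons)
      ultimately show ?thesis
        using less.IH(2)[of "b - Suc c" b "Suc c" "{c}"] True 1
        by (simp only: nc_series_Cons) simp
    qed
  }
  \<comment> \<open>Kept for the second claim at the same length: when the block ends, the gap is
    the whole interval.\<close>
  note one = this
  {
    case 2
    have "(\<Sum>\<pi>\<in>nc_partitions {c..<d}. \<Prod>V\<in>\<pi>. f (nths w V)) *
       (\<Sum>\<pi> | \<pi> \<in> nc_partitions (V0 \<union> {d..<b}) \<and> (\<exists>B\<in>\<pi>. V0 \<union> ({d} \<inter> {..<b}) \<subseteq> B).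
          \<Prod>V\<in>\<pi>. f (nths w V)) =
       nc_series f [] (slice w c d) * nc_series f (nths w V0) (slice w d b)"
      if d: "d \<in> {c..b}" for d
    proof -
      have "(\<Sum>\<pi>\<in>nc_partitions {c..<d}. \<Prod>V\<in>\<pi>. f (nths w V)) = nc_series f [] (slice w c d)"
      proof (cases "d = b")
        case True
        then show ?thesis using one[of b c] 2 by simp
      next
        case False
        then have "d - c < n" using d 2 by auto
        then show ?thesis using less.IH(1)[of "d - c" d c] d 2 by simp
      qed
      moreover have "(\<Sum>\<pi> | \<pi> \<in> nc_partitions (V0 \<union> {d..<b}) \<and>
          (\<exists>B\<in>\<pi>. V0 \<union> ({d} \<inter> {..<b}) \<subseteq> B). \<Prod>V\<in>\<pi>. f (nths w V)) =
          nc_series f (nths w V0) (slice w d b)"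
      proof (cases "d = b")
        case True
        \<comment> \<open>With \<open>d = b\<close> the block is complete and no later positions
          remain.\<close>
        have "{\<pi>. \<pi> \<in> nc_partitions V0 \<and> (\<exists>B\<in>\<pi>. V0 \<subseteq> B)} = {{V0}}"
        proof (intro equalityI subsetI)
          fix \<pi> assume "\<pi> \<in> {\<pi>. \<pi> \<in> nc_partitions V0 \<and> (\<exists>B\<in>\<pi>. V0 \<subseteq> B)}"
          then obtain B where \<pi>: "partition_on V0 \<pi>" "B \<in> \<pi>" "V0 \<subseteq> B"
            by (auto simp: nc_partitions_def)
          have sub: "W \<subseteq> V0" "W \<noteq> {}" if "W \<in> \<pi>" for W
            using \<pi>(1) that unfolding partition_on_def by blast+
          have B: "B = V0" using \<pi>(3) sub(1)[OF \<pi>(2)] by simp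
          have "W = B" if "W \<in> \<pi>" for W
          proof (rule ccontr)
            assume "W \<noteq> B"
            then have "W \<inter> B = {}"
              using \<pi>(1,2) that by (auto simp: partition_on_def dest: disjointD)
            then show False using sub[OF that] B by blast
          qed
          then show "\<pi> \<in> {{V0}}" using \<pi>(2) B by blast
        qed (use 2 in \<open>auto simp: nc_partitions_def noncrossing_def intro!: partition_on_space\<close>)
        then show ?thesis using True by simp
      next
        case False
        \<comment> \<open>Here \<open>d\<close> joins the block, so its letter is appended to the
          word read so far.\<close>
        have A: "V0 \<union> {d..<b} = insert d V0 \<union> {Suc d..<b}"
          "V0 \<union> ({d} \<inter> {..<b}) = insert d V0"
          using False d by auto
        have V0: "V0 \<subseteq> {..<d}" "insert d V0 \<subseteq> {..<Suc d}" and d': "d < length w" "d < b"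
          using False d 2 by auto
        show ?thesis
          unfolding A slice_Cons[OF d'(2) \<open>b \<le> length w\<close>] nc_series_Cons
            nths_insert_above[OF V0(1) d'(1), symmetric]
          by (rule less.IH(2)[OF _ refl]) (use V0 d d' 2 in auto)
      qed
      ultimately show ?thesis by simp
    qed
    then show ?case
      unfolding sum_nc_partitions_next[OF 2(4,5,2)] series_mult_slice[OF 2(2,3)]
      by (rule sum.cong[OF refl])
  }
qed

lemma sum_NC:
  fixes f :: "'k list \<Rightarrow> 'a::comm_ring_1"
  assumes "f [] = 1"
  shows "(\<Sum>\<pi>\<in>NC (length w). \<Prod>V\<in>\<pi>. f (nths w V)) = nc_series f [] w"
  using sum_nc_partitions_interval(1)[of f "length w" 0 "length w" w] assms
  by (simp add: NC_eq_nc_partitions atLeast0LessThan)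

section \<open>Interval partitions, split after the first block\<close>

function interval_series :: "('k list \<Rightarrow> 'a::comm_ring_1) \<Rightarrow> 'k list \<Rightarrow> 'a" where
  "interval_series f [] = 1"
| "interval_series f (i # w) =
     (\<Sum>j\<le>length w. f (i # take j w) * interval_series f (drop j w))"
  by pat_completeness auto
termination
  by (relation "Wellfounded.measure (\<lambda>(f, w). length w)") auto

lemma interval_series_Cons:
  "interval_series f (i # w) = ((\<lambda>u. f (i # u)) \<star> interval_series f) w"
  by (simp add: series_mult_def)

declare interval_series.simps(2) [simp del]

text \<open>The condition \<open>f [] = 0\<close> kills the cut before the first letter, leaving the
  recursion on the first block. This is the equation \<open>G = 1 + BG\<close>.\<close>

lemma interval_series_eq:
  assumes "f [] = 0"
  shows "interval_series f = (\<lambda>w. series_one w + (f \<star> interval_series f) w)"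
proof
  fix w
  show "interval_series f w = series_one w + (f \<star> interval_series f) w"
    using assms by (cases w) (simp_all add: series_mult_Cons interval_series_Cons series_one_def)
qed

definition interval_partitions :: "nat set \<Rightarrow> nat set set set" where
  "interval_partitions A = {\<pi>. partition_on A \<pi> \<and> (\<forall>V\<in>\<pi>. \<exists>i j. V = {i..j})}"

lemma IP_eq_interval_partitions: "IP n = interval_partitions {..<n}"
  by (simp add: IP_def interval_partitions_def)

lemma interval_partitions_empty: "interval_partitions {} = {{}}"
  by (auto simp: interval_partitions_def partition_on_empty)

lemma finite_interval_partitions: "finite A \<Longrightarrow> finite (interval_partitions A)"
  by (rule finite_subset[OF _ finitely_many_partition_on[of A]])
    (auto simp: interval_partitions_def)

text \<open>Makes the removal of the first block reversible; it gives both disjointness and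
  injectivity in the sum below.\<close>

lemma notin_interval_partitions:
  assumes "\<sigma> \<in> interval_partitions {e..<b}" "a < d" "a < e"
  shows "{a..<d} \<notin> \<sigma>"
proof
  assume "{a..<d} \<in> \<sigma>"
  then have "{a..<d} \<subseteq> {e..<b}"
    using assms(1) unfolding interval_partitions_def partition_on_def by blast
  moreover have "a \<in> {a..<d}" using assms(2) by simp
  ultimately show False using assms(3) by auto
qed

lemma interval_partitions_first:
  assumes "a < b"
  shows "interval_partitions {a..<b} =
    (\<Union>d\<in>{Suc a..b}. insert {a..<d} ` interval_partitions {d..<b})"
proof (intro equalityI subsetI)
  fix \<pi> assume \<pi>: "\<pi> \<in> interval_partitions {a..<b}"
  then have part: "partition_on {a..<b} \<pi>" by (simp add: interval_partitions_def)
  then have "a \<in> \<Union>\<pi>" using assms by (simp add: partition_on_def)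
  then obtain B where B: "B \<in> \<pi>" "a \<in> B" by blast
  then obtain i j where ij: "B = {i..j}" using \<pi> by (auto simp: interval_partitions_def)
  have sub: "B \<subseteq> {a..<b}" using part B(1) unfolding partition_on_def by blast
  have "i = a" using sub B(2) ij by (auto dest: subsetD[of _ _ i])
  moreover have "j < b" using sub B(2) ij by (auto dest: subsetD[of _ _ j])
  ultimately have d: "B = {a..<Suc j}" "Suc j \<in> {Suc a..b}" using ij B(2) by auto
  have "disjnt B (\<Union>(\<pi> - {B}))"
    using part B(1) by (auto simp: partition_on_def disjnt_def dest: disjointD)
  then have "partition_on ({a..<b} - B) (\<pi> - {B})"
    using part B(1) partition_on_insert[of B "\<pi> - {B}"] by (simp add: insert_absorb)
  moreover have "{a..<b} - B = {Suc j..<b}" using d by auto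
  ultimately have "\<pi> - {B} \<in> interval_partitions {Suc j..<b}"
    using \<pi> by (simp add: interval_partitions_def)
  moreover have "\<pi> = insert {a..<Suc j} (\<pi> - {B})" using B(1) d by auto
  ultimately show "\<pi> \<in> (\<Union>d\<in>{Suc a..b}. insert {a..<d} ` interval_partitions {d..<b})"
    using d(2) by blast
next
  fix \<pi> assume "\<pi> \<in> (\<Union>d\<in>{Suc a..b}. insert {a..<d} ` interval_partitions {d..<b})"
  then obtain d \<sigma> where d: "d \<in> {Suc a..b}" and \<sigma>: "\<sigma> \<in> interval_partitions {d..<b}"
    and \<pi>: "\<pi> = {{a..<d}} \<union> \<sigma>" by auto
  have "partition_on ({a..<d} \<union> {d..<b}) \<pi>"
    unfolding \<pi> using \<sigma> d
    by (intro partition_on_Un_disjoint partition_on_space) (auto simp: interval_partitions_def)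
  moreover have "{a..<d} \<union> {d..<b} = {a..<b}" using d by auto
  moreover have "\<exists>i j. V = {i..j}" if "V \<in> \<pi>" for V
  proof (cases "V = {a..<d}")
    case True
    have "{a..<d} = {a..d - 1}" using d by auto
    then show ?thesis using True by blast
  next
    case False
    then show ?thesis using \<sigma> \<pi> that by (auto simp: interval_partitions_def)
  qed
  ultimately show "\<pi> \<in> interval_partitions {a..<b}" by (simp add: interval_partitions_def)
qed

lemma sum_interval_partitions_first:
  fixes h :: "nat set \<Rightarrow> 'a::comm_ring_1"
  assumes "a < b"
  shows "(\<Sum>\<pi>\<in>interval_partitions {a..<b}. \<Prod>V\<in>\<pi>. h V) =
    (\<Sum>d\<in>{Suc a..b}. h {a..<d} * (\<Sum>\<pi>\<in>interval_partitions {d..<b}. \<Prod>V\<in>\<pi>. h V))"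
proof -
  have "(\<Sum>\<pi>\<in>interval_partitions {a..<b}. \<Prod>V\<in>\<pi>. h V) =
      (\<Sum>d\<in>{Suc a..b}. \<Sum>\<pi>\<in>insert {a..<d} ` interval_partitions {d..<b}. \<Prod>V\<in>\<pi>. h V)"
    unfolding interval_partitions_first[OF assms]
  proof (rule sum.UNION_disjoint)
    show "\<forall>d\<in>{Suc a..b}. finite (insert {a..<d} ` interval_partitions {d..<b})"
      by (simp add: finite_interval_partitions)
    \<comment> \<open>For distinct ends, \<open>{a..<d}\<close> would have to be a block of
      \<open>\<rho>\<close>, whose blocks all lie in \<open>{e..<b}\<close> and so miss
      \<open>a\<close>.\<close>
    have uniq: "d = e" if de: "d \<in> {Suc a..b}" "e \<in> {Suc a..b}"
      and \<sigma>: "\<sigma> \<in> interval_partitions {d..<b}" and \<rho>: "\<rho> \<in> interval_partitions {e..<b}"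
      and eq: "insert {a..<d} \<sigma> = insert {a..<e} \<rho>" for d e \<sigma> \<rho>
    proof (rule ccontr)
      assume "d \<noteq> e"
      then have "{a..<d} \<noteq> {a..<e}" using de by (simp add: atLeastLessThan_eq_iff Suc_le_eq)
      then have "{a..<d} \<in> \<rho>" using eq by blast
      then show False using notin_interval_partitions[OF \<rho>] de by simp
    qed
    show "\<forall>d\<in>{Suc a..b}. \<forall>e\<in>{Suc a..b}. d \<noteq> e \<longrightarrow>
        insert {a..<d} ` interval_partitions {d..<b} \<inter>
        insert {a..<e} ` interval_partitions {e..<b} = {}"
    proof (intro ballI impI, rule ccontr)
      fix d e assume de: "d \<in> {Suc a..b}" "e \<in> {Suc a..b}" "d \<noteq> e"
        and "insert {a..<d} ` interval_partitions {d..<b} \<inter>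
          insert {a..<e} ` interval_partitions {e..<b} \<noteq> {}"
      then obtain \<pi> where \<pi>: "\<pi> \<in> insert {a..<d} ` interval_partitions {d..<b}"
        "\<pi> \<in> insert {a..<e} ` interval_partitions {e..<b}" by (metis disjoint_iff)
      from \<pi>(1) obtain \<sigma> where \<sigma>: "\<pi> = insert {a..<d} \<sigma>" "\<sigma> \<in> interval_partitions {d..<b}"
        by (rule imageE)
      from \<pi>(2) obtain \<rho> where \<rho>: "\<pi> = insert {a..<e} \<rho>" "\<rho> \<in> interval_partitions {e..<b}"
        by (rule imageE)
      show False using uniq[OF de(1,2) \<sigma>(2) \<rho>(2)] \<sigma>(1) \<rho>(1) de(3) by simp
    qed
  qed simp
  also have "\<dots> = (\<Sum>d\<in>{Suc a..b}. h {a..<d} *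
      (\<Sum>\<pi>\<in>interval_partitions {d..<b}. \<Prod>V\<in>\<pi>. h V))"
  proof (rule sum.cong[OF refl])
    fix d assume d: "d \<in> {Suc a..b}"
    have nin: "{a..<d} \<notin> \<sigma>" if "\<sigma> \<in> interval_partitions {d..<b}" for \<sigma>
      using notin_interval_partitions[OF that] d by simp
    have "inj_on (insert {a..<d}) (interval_partitions {d..<b})"
      by (rule inj_onI) (metis nin insert_ident)
    moreover have "(\<Prod>V\<in>insert {a..<d} \<sigma>. h V) = h {a..<d} * (\<Prod>V\<in>\<sigma>. h V)"
      if "\<sigma> \<in> interval_partitions {d..<b}" for \<sigma>
    proof -
      have "finite \<sigma>"
        using that finite_elements[of "{d..<b}" \<sigma>] by (simp add: interval_partitions_def)
      then show ?thesis using nin[OF that] by simp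
    qed
    ultimately show "(\<Sum>\<pi>\<in>insert {a..<d} ` interval_partitions {d..<b}. \<Prod>V\<in>\<pi>. h V) =
        h {a..<d} * (\<Sum>\<pi>\<in>interval_partitions {d..<b}. \<Prod>V\<in>\<pi>. h V)"
      by (simp add: sum.reindex sum_distrib_left)
  qed
  finally show ?thesis .
qed

lemma sum_interval_partitions_interval:
  fixes f :: "'k list \<Rightarrow> 'a::comm_ring_1"
  assumes "a \<le> b" "b \<le> length w"
  shows "(\<Sum>\<pi>\<in>interval_partitions {a..<b}. \<Prod>V\<in>\<pi>. f (nths w V)) =
    interval_series f (slice w a b)"
  using assms
proof (induction "b - a" arbitrary: a rule: less_induct)
  case less
  show ?case
  proof (cases "a < b")
    case False
    then show ?thesis using less.prems by (simp add: interval_partitions_empty)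
  next
    case True
    have slice: "slice w a d = w ! a # slice w (Suc a) d" if "d \<in> {Suc a..b}" for d
      using that less.prems by (intro slice_Cons) auto
    have "(\<Sum>\<pi>\<in>interval_partitions {a..<b}. \<Prod>V\<in>\<pi>. f (nths w V)) =
        (\<Sum>d\<in>{Suc a..b}. f (w ! a # slice w (Suc a) d) * interval_series f (slice w d b))"
      unfolding sum_interval_partitions_first[OF True]
    proof (rule sum.cong[OF refl])
      fix d assume d: "d \<in> {Suc a..b}"
      have "nths w {a..<d} = slice w a d" using d less.prems by (intro nths_interval) auto
      moreover have "b - d < b - a" "d \<le> b" using d by auto
      ultimately show "f (nths w {a..<d}) *
          (\<Sum>\<pi>\<in>interval_partitions {d..<b}. \<Prod>V\<in>\<pi>. f (nths w V)) =
          f (w ! a # slice w (Suc a) d) * interval_series f (slice w d b)"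
        using less.hyps[of d] less.prems slice[OF d] by (simp only:)
    qed
    also have "\<dots> = interval_series f (w ! a # slice w (Suc a) b)"
      unfolding interval_series_Cons using True less.prems
      by (intro series_mult_slice[symmetric]) auto
    also have "w ! a # slice w (Suc a) b = slice w a b" using slice[of b] True by simp
    finally show ?thesis .
  qed
qed

lemma sum_IP:
  fixes f :: "'k list \<Rightarrow> 'a::comm_ring_1"
  shows "(\<Sum>\<pi>\<in>IP (length w). \<Prod>V\<in>\<pi>. f (nths w V)) = interval_series f w"
  using sum_interval_partitions_interval[of 0 "length w" w f]
  by (simp add: IP_eq_interval_partitions atLeast0LessThan)


section \<open>Cumulants of infinitesimal laws\<close>

text \<open>Because hbar squares to 0, the soul of a product obeys the Leibniz rule.\<close>

lemma prod_Grassmann: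
  "finite S \<Longrightarrow> (\<Prod>V\<in>S. Grassmann (f V) (f' V)) =
     Grassmann (\<Prod>V\<in>S. f V) (\<Sum>V\<in>S. f' V * (\<Prod>W\<in>S - {V}. f W))"
proof (induction S rule: finite_induct)
  case (insert x S)
  have "(\<Prod>W\<in>insert x S - {V}. f W) = f x * (\<Prod>W\<in>S - {V}. f W)" if "V \<in> S" for V
  proof -
    have "insert x S - {V} = insert x (S - {V})" using insert that by auto
    then show ?thesis using insert by simp
  qed
  then have "(\<Sum>V\<in>S. f' V * (\<Prod>W\<in>insert x S - {V}. f W)) =
      f x * (\<Sum>V\<in>S. f' V * (\<Prod>W\<in>S - {V}. f W))"
    by (simp add: sum_distrib_left algebra_simps)
  then show ?case using insert by (simp add: times_grassmann_def algebra_simps)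
qed (simp add: one_grassmann_def)

lemma sum_Grassmann: "(\<Sum>x\<in>S. Grassmann (f x) (g x)) = Grassmann (\<Sum>x\<in>S. f x) (\<Sum>x\<in>S. g x)"
  by (induction S rule: infinite_finite_induct)
    (simp_all add: zero_grassmann_def plus_grassmann_def)

text \<open>The Leibniz rule packs a partition product and its derivative into one product over the
  Grassmann algebra, so ordinary and infinitesimal formulas are handled together.\<close>

lemma Grassmann_part_prod:
  assumes "partition_on {..<n} \<pi>"
  shows "Grassmann (part_prod f \<pi> xs) (part_deriv f f' \<pi> xs) =
    (\<Prod>V\<in>\<pi>. Grassmann (f (nths xs V)) (f' (nths xs V)))"
  unfolding part_prod_def part_deriv_def
  by (rule prod_Grassmann[symmetric], rule finite_elements[OF _ assms]) simp

definition momentG :: "'k inf_law \<Rightarrow> 'k list \<Rightarrow> grassmann" where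
  "momentG M w = Grassmann (law M (prod_list (map X w))) (law' M (prod_list (map X w)))"

lemma momentG_Nil [simp]: "momentG M [] = 1"
  by (simp add: momentG_def law_props one_grassmann_def)

lemma free_cumulantG_Nil [simp]: "free_cumulantG M [] = 0"
proof -
  \<comment> \<open>A single empty block is not a partition, so the subtracted sum at length 0
    consists of the empty partition, with product 1 and derivative 0.\<close>
  have "NC 0 - {{{}}} = {{}}" by (auto simp: NC_def partition_on_empty)
  then have "free_cumulant \<phi> [] = \<phi> 1 - 1" "inf_free_cumulant \<phi> \<phi>' [] = \<phi>' 1"
    for \<phi> \<phi>' :: "'a ncpoly \<Rightarrow> complex"
    by (subst free_cumulant.simps inf_free_cumulant.simps, simp add: part_prod_def part_deriv_def)+
  then show ?thesis by (simp add: free_cumulantG_def law_props zero_grassmann_def)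
qed

lemma boolean_cumulantG_Nil [simp]: "boolean_cumulantG M [] = 0"
proof -
  have "IP 0 - {{{}}} = {{}}" by (auto simp: IP_def partition_on_empty)
  then have "boolean_cumulant \<phi> [] = \<phi> 1 - 1" "inf_boolean_cumulant \<phi> \<phi>' [] = \<phi>' 1"
    for \<phi> \<phi>' :: "'a ncpoly \<Rightarrow> complex"
    by (subst boolean_cumulant.simps inf_boolean_cumulant.simps,
        simp add: part_prod_def part_deriv_def)+
  then show ?thesis by (simp add: boolean_cumulantG_def law_props zero_grassmann_def)
qed

lemma momentG_free:
  assumes "w \<noteq> []"
  shows "momentG M w = (\<Sum>\<pi>\<in>NC (length w). \<Prod>V\<in>\<pi>. free_cumulantG M (nths w V))"
  unfolding momentG_def free_cumulantG_def
  using assms moment_free_cumulant[of "map X w" "law M"]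
    inf_moment_free_cumulant[of "map X w" "law' M" "law M"]
  by (simp add: nths_map sum_Grassmann[symmetric] Grassmann_part_prod[OF partition_on_NC])

lemma momentG_boolean:
  assumes "w \<noteq> []"
  shows "momentG M w = (\<Sum>\<pi>\<in>IP (length w). \<Prod>V\<in>\<pi>. boolean_cumulantG M (nths w V))"
  unfolding momentG_def boolean_cumulantG_def
  using assms moment_boolean_cumulant[of "map X w" "law M"]
    inf_moment_boolean_cumulant[of "map X w" "law' M" "law M"]
  by (simp add: nths_map sum_Grassmann[symmetric] Grassmann_part_prod[OF partition_on_IP])

lemma momentG_eq_boolean:
  "momentG M = (\<lambda>w. series_one w + (boolean_cumulantG M \<star> momentG M) w)"
proof -
  have "momentG M w = interval_series (boolean_cumulantG M) w" for w
    by (cases "w = []") (simp_all add: momentG_boolean sum_IP)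
  then have "momentG M = interval_series (boolean_cumulantG M)" by blast
  then show ?thesis using interval_series_eq[of "boolean_cumulantG M"] by simp
qed

lemma momentG_eq_free:
  "momentG M = (\<lambda>w. series_one w + series_subst (momentG M) (free_cumulantG M) w)"
proof -
  \<comment> \<open>Adding \<open>series_one\<close> sets the value at the empty word to 1, as
    \<open>sum_NC\<close> requires; blocks are nonempty, so their weights do not change.\<close>
  define f where "f = (\<lambda>w. series_one w + free_cumulantG M w)"
  have f: "f w = (if w = [] then 1 else free_cumulantG M w)" for w
    by (simp add: f_def series_one_def)
  have "momentG M w = nc_series f [] w" for w
  proof (cases "w = []")
    case False
    have "(\<Prod>V\<in>\<pi>. free_cumulantG M (nths w V)) = (\<Prod>V\<in>\<pi>. f (nths w V))"
      if "\<pi> \<in> NC (length w)" for \<pi>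
      using nths_block_nonempty[OF partition_on_NC[OF that]] by (intro prod.cong) (auto simp: f)
    then show ?thesis using False by (simp add: momentG_free sum_NC[of f, symmetric] f)
  qed (simp add: f)
  then have "momentG M = nc_series f []" by blast
  then have "momentG M = series_subst (momentG M) f"
    using nc_series_eq_subst[of f "[]"] by simp
  also have "\<dots> = (\<lambda>w. series_one w + series_subst (momentG M) (free_cumulantG M) w)"
    by (simp add: f_def series_subst_add series_subst_one)
  finally show ?thesis .
qed

text \<open>The Boolean and the free equation express the same moment series, which is the witness;
  comparing them gives \<open>BG = R(zG)\<close>.\<close>

lemma cumulant_flow_law: "cumulant_flow 1 (free_cumulantG M) (boolean_cumulantG M)"
proof -
  have "(boolean_cumulantG M \<star> momentG M) w =
      series_subst (momentG M) (free_cumulantG M) w" for w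
    using fun_cong[OF momentG_eq_boolean, of M w] fun_cong[OF momentG_eq_free, of M w] by simp
  then have "boolean_cumulantG M \<star> momentG M = series_subst (momentG M) (free_cumulantG M)"
    by blast
  moreover have "momentG M = (\<lambda>w. series_one w + 1 * (boolean_cumulantG M \<star> momentG M) w)"
    using momentG_eq_boolean by simp
  ultimately show ?thesis
    unfolding cumulant_flow_def by (intro conjI exI[of _ "momentG M"]) simp_all
qed

section \<open>Convolution powers and the group law on cumulants\<close>

lemma all_nonempty_lists:
  "(\<forall>n\<ge>1. \<forall>ks. length ks = n \<longrightarrow> P ks) \<longleftrightarrow> (\<forall>ks. ks \<noteq> [] \<longrightarrow> P ks)"
  by (metis One_nat_def Suc_leI length_greater_0_conv less_eq_Suc_le)

lemma free_cumulantG_free_power: "free_cumulantG (free_power M s) ks = s *\<^sub>R free_cumulantG M ks"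
  using theI'[OF free_cumulantG_ex1[of "\<lambda>ks. s *\<^sub>R free_cumulantG M ks"]]
  unfolding free_power_def all_nonempty_lists by (cases "ks = []") simp_all

lemma boolean_cumulantG_boolean_power:
  "boolean_cumulantG (boolean_power M s) ks = s *\<^sub>R boolean_cumulantG M ks"
  using theI'[OF boolean_cumulantG_ex1[of "\<lambda>ks. s *\<^sub>R boolean_cumulantG M ks"]]
  unfolding boolean_power_def all_nonempty_lists by (cases "ks = []") simp_all

lemma free_cumulantG_BBP: "free_cumulantG (BBP M) = boolean_cumulantG M"
proof
  fix ks
  show "free_cumulantG (BBP M) ks = boolean_cumulantG M ks"
    using theI'[OF free_cumulantG_ex1[of "boolean_cumulantG M"]]
    unfolding BBP_def all_nonempty_lists by (cases "ks = []") simp_all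
qed

lemma free_cumulantG_inject: "free_cumulantG M = free_cumulantG N \<Longrightarrow> M = N"
  using free_cumulantG_ex1[of "free_cumulantG N"] by metis

lemma boolean_cumulantG_inject: "boolean_cumulantG M = boolean_cumulantG N \<Longrightarrow> M = N"
  using boolean_cumulantG_ex1[of "boolean_cumulantG N"] by metis

lemma ex_law_free_cumulantG:
  assumes "f [] = 0"
  obtains N where "free_cumulantG N = f"
proof -
  obtain N where N: "\<forall>ks. ks \<noteq> [] \<longrightarrow> free_cumulantG N ks = f ks"
    using free_cumulantG_ex1[of f] unfolding all_nonempty_lists by blast
  have "free_cumulantG N ks = f ks" for ks using N assms by (cases "ks = []") auto
  then show ?thesis using that by blast
qed

text \<open>The time-1 relation of \<open>N\<close> links \<open>s f\<close> with \<open>s\<close>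
  times the Boolean cumulants of its power \<open>1 / s\<close>; rescaling by \<open>s\<close> turns
  this into time \<open>s\<close>.\<close>

lemma cumulant_flow_boolean_power:
  assumes "s \<noteq> 0" "free_cumulantG N = (\<lambda>w. of_real s * f w)"
  shows "cumulant_flow (of_real s) f (boolean_cumulantG (boolean_power N (1 / s)))"
proof (rule cumulant_flow_scale)
  have "of_real s * boolean_cumulantG (boolean_power N (1 / s)) w = boolean_cumulantG N w" for w
    using assms(1)
    by (simp add: boolean_cumulantG_boolean_power scaleR_conv_of_real[symmetric])
  then show "cumulant_flow 1 (\<lambda>w. of_real s * f w)
      (\<lambda>w. of_real s * boolean_cumulantG (boolean_power N (1 / s)) w)"
    using cumulant_flow_law[of N] assms(2) by simp
  show "of_real s * of_real (1 / s) = (1 :: grassmann)"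
    using assms(1) by (simp add: of_real_mult[symmetric] del: of_real_mult)
qed

text \<open>A law with free cumulants \<open>s f\<close> realizes the image at every nonzero time
  \<open>s\<close>, negative times included, which is what makes the flow invertible.\<close>

lemma cumulant_flow_exists:
  fixes f :: "'k list \<Rightarrow> grassmann"
  assumes "f [] = 0"
  obtains H where "cumulant_flow (of_real s) f H"
proof (cases "s = 0")
  case True
  then show ?thesis using that cumulant_flow_zero[of f] assms by simp
next
  case False
  obtain N where "free_cumulantG N = (\<lambda>w. of_real s * f w)"
    using ex_law_free_cumulantG[of "\<lambda>w. of_real s * f w"] assms by auto
  then show ?thesis using that cumulant_flow_boolean_power[OF False] by blast
qed

text \<open>Flowing from \<open>H\<close> for time \<open>t - s\<close> reaches a
  time-\<open>t\<close> image of \<open>f\<close>, which is \<open>K\<close> by uniqueness.\<close>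

lemma cumulant_flow_cancel:
  fixes f :: "'k list \<Rightarrow> grassmann"
  assumes "cumulant_flow (of_real s) f H" "cumulant_flow (of_real t) f K" "H [] = 0"
  shows "cumulant_flow (of_real (t - s)) H K"
proof -
  obtain K' where K': "cumulant_flow (of_real (t - s)) H K'"
    using cumulant_flow_exists[of H] assms(3) by blast
  then have "cumulant_flow (of_real t) f K'"
    using cumulant_flow_compose[OF assms(1) K'] by (simp add: of_real_diff)
  then show ?thesis using K' cumulant_flow_unique assms(2) by metis
qed

text \<open>From the free cumulants of \<open>M\<close> the two powers give time
  \<open>1 + t\<close>; the first unit of time leads to the Boolean cumulants of \<open>M\<close>
  and is cancelled.\<close>

lemma cumulant_flow_BBP_semigroup:
  assumes "t \<ge> 0"
  shows "cumulant_flow (of_real t) (boolean_cumulantG M) (boolean_cumulantG (BBP_semigroup t M))"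
proof -
  have "free_cumulantG (free_power M (1 + t)) = (\<lambda>w. of_real (1 + t) * free_cumulantG M w)"
    by (auto simp: free_cumulantG_free_power scaleR_conv_of_real)
  then have "cumulant_flow (of_real (1 + t)) (free_cumulantG M)
      (boolean_cumulantG (BBP_semigroup t M))"
    unfolding BBP_semigroup_def using assms by (intro cumulant_flow_boolean_power) auto
  then show ?thesis
    using cumulant_flow_cancel[of 1 "free_cumulantG M" "boolean_cumulantG M" "1 + t"]
      cumulant_flow_law[of M] by simp
qed

text \<open>The Boolean cumulants of the new law are the time-1 image of its own free cumulants and
  also of the Boolean cumulants of \<open>M\<close>; flowing back identifies the two.\<close>

lemma free_cumulantG_BBP_semigroup_1: "free_cumulantG (BBP_semigroup 1 M) = boolean_cumulantG M"
proof -
  let ?N = "BBP_semigroup 1 M"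
  have 1: "cumulant_flow 1 (free_cumulantG ?N) (boolean_cumulantG ?N)"
    "cumulant_flow 1 (boolean_cumulantG M) (boolean_cumulantG ?N)"
    using cumulant_flow_law cumulant_flow_BBP_semigroup[of 1 M] by auto
  \<comment> \<open>Since \<open>f\<close> is its own time-0 image, cancelling time 1 against time 0
    leads back at time -1.\<close>
  have inverse: "cumulant_flow (of_real (0 - 1)) (boolean_cumulantG ?N) f"
    if "cumulant_flow 1 f (boolean_cumulantG ?N)" for f
    using that cumulant_flow_zero[of f]
    by (intro cumulant_flow_cancel[of 1 f]) (auto simp: cumulant_flow_def)
  show ?thesis using cumulant_flow_unique[OF inverse inverse] 1 by blast
qed

theorem theorem1p2:
  shows "(\<forall>s\<ge>0. \<forall>t\<ge>0.
        (BBP_semigroup s \<circ> BBP_semigroup t :: 'k::finite inf_law \<Rightarrow> 'k inf_law) =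
        BBP_semigroup (s + t)) \<and>
    (\<forall>M :: 'k inf_law.
        (\<forall>n\<ge>1. \<forall>ks. length ks = n \<longrightarrow>
          free_cumulantG (BBP_semigroup 1 M) ks = boolean_cumulantG M ks) \<and>
        BBP_semigroup 1 M = BBP M)"
proof (intro conjI allI impI)
  fix s t :: real assume st: "0 \<le> s" "0 \<le> t"
  show "(BBP_semigroup s \<circ> BBP_semigroup t :: 'k inf_law \<Rightarrow> 'k inf_law) = BBP_semigroup (s + t)"
  proof
    fix M :: "'k inf_law"
    \<comment> \<open>Both laws have the time-\<open>(s + t)\<close> image of the Boolean cumulants
      of \<open>M\<close> as Boolean cumulants, and these determine a law.\<close>
    have "cumulant_flow (of_real s + of_real t) (boolean_cumulantG M)
        (boolean_cumulantG (BBP_semigroup s (BBP_semigroup t M)))"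
      using st by (intro cumulant_flow_compose[OF cumulant_flow_BBP_semigroup
            cumulant_flow_BBP_semigroup])
    moreover have "cumulant_flow (of_real s + of_real t) (boolean_cumulantG M)
        (boolean_cumulantG (BBP_semigroup (s + t) M))"
      using st cumulant_flow_BBP_semigroup[of "s + t" M] by simp
    ultimately show "(BBP_semigroup s \<circ> BBP_semigroup t) M = BBP_semigroup (s + t) M"
      using cumulant_flow_unique boolean_cumulantG_inject by (metis comp_apply)
  qed
next
  fix M :: "'k inf_law"
  show "BBP_semigroup 1 M = BBP M"
    by (rule free_cumulantG_inject)
      (simp add: free_cumulantG_BBP_semigroup_1 free_cumulantG_BBP)
qed (simp add: free_cumulantG_BBP_semigroup_1)

end
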